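(* Let $\mathrm{CUBE}(\square_S^{op}\mathbf{Set}\downarrow{!^S\Sigma})$ be the full subcategory of labelled symmetric precubical sets containing the labelled cubes $\square_S[a_1,\dots,a_n]$ with $n\ge0$ and $a_1,\dots,a_n\in\Sigma$, and let $\mathrm{CUBE}(\mathbf{WHDTS})$ be the full subcategory of weak higher dimensional transition systems containing the labelled cubes $C_n[a_1,\dots,a_n]$ with $n\ge0$ and $a_1,\dots,a_n\in\Sigma$. The functor $$\mathbb T:\mathrm{CUBE}(\square_S^{op}\mathbf{Set}\downarrow{!^S\Sigma})\longrightarrow\mathrm{CUBE}(\mathbf{WHDTS})$$ given by $\mathbb T(\square_S[a_1,\dots,a_n])=C_n[a_1,\dots,a_n]$ and $f\mapsto\mathbb T(f)$ is an isomorphism of categories.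
   Context: $\Sigma$ is a fixed nonempty set of labels. A weak higher dimensional transition system is a triple $(S,\mu:L\to\Sigma,T=\bigcup_{n\ge1}T_n)$ with $S$ a set (states), $L$ a set (actions), $\mu$ a set map (labelling map) and $T_n\subset S\times L^n\times S$ ($n$-transitions) such that: - (Multiset axiom) for every permutation $\sigma$ of $\{1,\dots,n\}$, $n\ge2$, if $(\alpha,u_1,\dots,u_n,\beta)\in T$ then $(\alpha,u_{\sigma(1)},\dots,u_{\sigma(n)},\beta)\in T$; - (Coherence axiom) for $n\ge3$, $p,q\ge1$ with $p+q<n$, if $(\alpha,u_1,\dots,u_n,\beta)$, $(\alpha,u_1,\dots,u_p,\nu_1)$, $(\nu_1,u_{p+1},\dots,u_n,\beta)$, $(\alpha,u_1,\dots,u_{p+q},\nu_2)$, $(\nu_2,u_{p+q+1},\dots,u_n,\beta)$ are transitions, then $(\nu_1,u_{p+1},\dots,u_{p+q},\nu_2)$ is a transition. A morphism $f$ consists of a map $f_0$ on states and a map $\widetilde f$ on actions commuting with the labelling maps, such that $(f_0(\alpha),\widetilde f(u_1),\dots,\widetilde f(u_n),f_0(\beta))$ is a transition whenever $(\alpha,u_1,\dots,u_n,\beta)$ is. The category is $\mathbf{WHDTS}$. $C_n[a_1,\dots,a_n]$ has set of states $\{0,1\}^n$ (a singleton for $n=0$), set of actions $\{(a_1,1),\dots,(a_n,n)\}$, labelling $\mu(a_i,i)=a_i$, and its $d$-transitions ($d\ge1$) are the tuples $((\epsilon_1,\dots,\epsilon_n),(a_{i_1},i_1),\dots,(a_{i_d},i_d),(\epsilon_1',\dots,\epsilon_n'))$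 with $i_1,\dots,i_d$ pairwise distinct, $\epsilon_i\le\epsilon_i'$ for all $i$, and $\epsilon_i\ne\epsilon_i'$ iff $i\in\{i_1,\dots,i_d\}$. $\square_S$ is the category with objects $[n]=\{0,1\}^n$, $n\ge0$, whose morphisms are the set maps generated by the face maps $\delta_i^\alpha(\epsilon_1,\dots,\epsilon_{n-1})=(\epsilon_1,\dots,\epsilon_{i-1},\alpha,\epsilon_i,\dots,\epsilon_{n-1})$ ($\alpha\in\{0,1\}$) and the symmetry maps $\sigma_i:[n]\to[n]$ exchanging coordinates $i$ and $i+1$. A symmetric precubical set is a presheaf on $\square_S$; $\square_S[n]=\square_S(-,[n])$. The symmetric precubical set $!^S\Sigma$ has $(!^S\Sigma)_n=\Sigma^n$, where $(\delta_i^0)^*=(\delta_i^1)^*$ removes the $i$-th letter and $\sigma_i^*$ exchanges letters $i$ and $i+1$. A labelled symmetric precubical set is an object of the comma category $\square_S^{op}\mathbf{Set}\downarrow{!^S\Sigma}$. The labelled cube $\square_S[a_1,\dots,a_n]$ is $\square_S[n]\to{!^S\Sigma}$ corresponding to $(a_1,\dots,a_n)\in\Sigma^n$. For a map of labelled cubes $f:\square_S[a_1,\dots,a_m]\to\square_S[b_1,\dots,b_n]$, with underlying map $f_0:[m]\to[n]$ of $\square_S$, there is a unique set map $\widehat f:\{1,\dots,n\}\to\{1,\dots,m\}\cup\{-\infty,+\infty\}$ with $f_0(\epsilon_1,\dots,\epsilon_m)=(\epsilon_{\widehat f(1)},\dots,\epsilon_{\widehat f(n)})$ for all $(\epsilon_1,\dots,\epsilon_m)\in[m]$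 (with $\epsilon_{-\infty}=0$, $\epsilon_{+\infty}=1$); it restricts to a bijection $\overline f:\widehat f^{-1}(\{1,\dots,m\})\to\{1,\dots,m\}$ and $a_i=b_{\overline f^{-1}(i)}$. The map $\mathbb T(f):C_m[a_1,\dots,a_m]\to C_n[b_1,\dots,b_n]$ is $f_0$ on states and $(a_i,i)\mapsto(a_i,\overline f^{-1}(i))$ on actions. This defines a functor. *)

theory Defs
  imports "HOL-Library.FuncSet" "HOL-Library.Extended" "HOL-Combinatorics.Permutations"
begin

section \<open>Categories and functors\<close>

text \<open>All maps are taken extensional (\<^term>\<open>undefined\<close> outside their domain), so that HOL equality
  of objects and of arrows is the intended equality. \<^term>\<open>Cmp C g f\<close> is \<open>g\<close> after \<open>f\<close>.\<close>

record ('o, 'm) category =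
  Obj :: "'o set"
  Arr :: "'m set"
  Dom :: "'m \<Rightarrow> 'o"
  Cod :: "'m \<Rightarrow> 'o"
  Ide :: "'o \<Rightarrow> 'm"
  Cmp :: "'m \<Rightarrow> 'm \<Rightarrow> 'm"

definition is_category :: "('o, 'm) category \<Rightarrow> bool" where
  "is_category C \<longleftrightarrow>
     (\<forall>f\<in>Arr C. Dom C f \<in> Obj C \<and> Cod C f \<in> Obj C) \<and>
     (\<forall>x\<in>Obj C. Ide C x \<in> Arr C \<and> Dom C (Ide C x) = x \<and> Cod C (Ide C x) = x) \<and>
     (\<forall>f\<in>Arr C. \<forall>g\<in>Arr C. Cod C f = Dom C g \<longrightarrow>
        Cmp C g f \<in> Arr C \<and> Dom C (Cmp C g f) = Dom C f \<and> Cod C (Cmp C g f) = Cod C g) \<and>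
     (\<forall>f\<in>Arr C. Cmp C f (Ide C (Dom C f)) = f \<and> Cmp C (Ide C (Cod C f)) f = f) \<and>
     (\<forall>f\<in>Arr C. \<forall>g\<in>Arr C. \<forall>h\<in>Arr C. Cod C f = Dom C g \<longrightarrow> Cod C g = Dom C h \<longrightarrow>
        Cmp C h (Cmp C g f) = Cmp C (Cmp C h g) f)"

definition hom_set :: "('o, 'm) category \<Rightarrow> 'o \<Rightarrow> 'o \<Rightarrow> 'm set" where
  "hom_set C x y = {f \<in> Arr C. Dom C f = x \<and> Cod C f = y}"

definition full_subcategory :: "('o, 'm) category \<Rightarrow> 'o set \<Rightarrow> ('o, 'm) category" where
  "full_subcategory C P =
     C\<lparr>Obj := Obj C \<inter> P, Arr := {f \<in> Arr C. Dom C f \<in> P \<and> Cod C f \<in> P}\<rparr>"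

definition is_functor ::
  "('o, 'm) category \<Rightarrow> ('p, 'n) category \<Rightarrow> ('o \<Rightarrow> 'p) \<Rightarrow> ('m \<Rightarrow> 'n) \<Rightarrow> bool" where
  "is_functor C D Fo Fm \<longleftrightarrow>
     is_category C \<and> is_category D \<and>
     (\<forall>x\<in>Obj C. Fo x \<in> Obj D) \<and>
     (\<forall>f\<in>Arr C. Fm f \<in> Arr D \<and> Dom D (Fm f) = Fo (Dom C f) \<and> Cod D (Fm f) = Fo (Cod C f)) \<and>
     (\<forall>x\<in>Obj C. Fm (Ide C x) = Ide D (Fo x)) \<and>
     (\<forall>f\<in>Arr C. \<forall>g\<in>Arr C. Cod C f = Dom C g \<longrightarrow> Fm (Cmp C g f) = Cmp D (Fm g) (Fm f))"

definition is_isomorphism_of_categories ::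
  "('o, 'm) category \<Rightarrow> ('p, 'n) category \<Rightarrow> ('o \<Rightarrow> 'p) \<Rightarrow> ('m \<Rightarrow> 'n) \<Rightarrow> bool" where
  "is_isomorphism_of_categories C D Fo Fm \<longleftrightarrow>
     is_functor C D Fo Fm \<and>
     (\<exists>Go Gm. is_functor D C Go Gm \<and>
        (\<forall>x\<in>Obj C. Go (Fo x) = x) \<and> (\<forall>f\<in>Arr C. Gm (Fm f) = f) \<and>
        (\<forall>y\<in>Obj D. Fo (Go y) = y) \<and> (\<forall>g\<in>Arr D. Fm (Gm g) = g))"


section \<open>Presheaves\<close>

record ('o, 'm, 'x) presheaf =
  Sec :: "'o \<Rightarrow> 'x set"
  Res :: "'m \<Rightarrow> 'x \<Rightarrow> 'x"

definition is_presheaf :: "('o, 'm) category \<Rightarrow> ('o, 'm, 'x) presheaf \<Rightarrow> bool" where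
  "is_presheaf C K \<longleftrightarrow>
     Sec K \<in> extensional (Obj C) \<and> Res K \<in> extensional (Arr C) \<and>
     (\<forall>f\<in>Arr C. Res K f \<in> Sec K (Cod C f) \<rightarrow>\<^sub>E Sec K (Dom C f)) \<and>
     (\<forall>x\<in>Obj C. Res K (Ide C x) = (\<lambda>s\<in>Sec K x. s)) \<and>
     (\<forall>f\<in>Arr C. \<forall>g\<in>Arr C. Cod C f = Dom C g \<longrightarrow>
        Res K (Cmp C g f) = compose (Sec K (Cod C g)) (Res K f) (Res K g))"

text \<open>The sections of the two presheaves may have different HOL types.\<close>

definition is_natural ::
  "('o, 'm) category \<Rightarrow> ('o, 'm, 'x) presheaf \<Rightarrow> ('o, 'm, 'y) presheaf \<Rightarrow> ('o \<Rightarrow> 'x \<Rightarrow> 'y) \<Rightarrow> bool"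
  where
  "is_natural C K K' \<eta> \<longleftrightarrow>
     \<eta> \<in> (\<Pi>\<^sub>E x\<in>Obj C. Sec K x \<rightarrow>\<^sub>E Sec K' x) \<and>
     (\<forall>f\<in>Arr C. \<forall>s\<in>Sec K (Cod C f). \<eta> (Dom C f) (Res K f s) = Res K' f (\<eta> (Cod C f) s))"

definition representable :: "('o, 'm) category \<Rightarrow> 'o \<Rightarrow> ('o, 'm, 'm) presheaf" where
  "representable C c =
     \<lparr>Sec = (\<lambda>x\<in>Obj C. hom_set C x c),
      Res = (\<lambda>f\<in>Arr C. \<lambda>g\<in>hom_set C (Cod C f) c. Cmp C g f)\<rparr>"

text \<open>The map from the presheaf represented by \<open>c\<close> to \<open>K\<close> that corresponds to \<open>s \<in> Sec K c\<close>
  under the Yoneda lemma.\<close>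

definition yoneda_map ::
  "('o, 'm) category \<Rightarrow> ('o, 'm, 'x) presheaf \<Rightarrow> 'o \<Rightarrow> 'x \<Rightarrow> 'o \<Rightarrow> 'm \<Rightarrow> 'x" where
  "yoneda_map C K c s = (\<lambda>x\<in>Obj C. \<lambda>g\<in>hom_set C x c. Res K g s)"

text \<open>The comma category of presheaves (with sections in \<^typ>\<open>'x\<close>) over a fixed presheaf \<open>B\<close>;
  an arrow is a triple (source, natural transformation, target).\<close>

type_synonym ('o, 'm, 'x, 'y) over = "('o, 'm, 'x) presheaf \<times> ('o \<Rightarrow> 'x \<Rightarrow> 'y)"

type_synonym ('o, 'm, 'x, 'y) over_map =
  "('o, 'm, 'x, 'y) over \<times> ('o \<Rightarrow> 'x \<Rightarrow> 'x) \<times> ('o, 'm, 'x, 'y) over"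

definition is_over ::
  "('o, 'm) category \<Rightarrow> ('o, 'm, 'y) presheaf \<Rightarrow> ('o, 'm, 'x, 'y) over \<Rightarrow> bool" where
  "is_over C B X \<longleftrightarrow> is_presheaf C (fst X) \<and> is_natural C (fst X) B (snd X)"

definition is_over_map :: "('o, 'm) category \<Rightarrow> ('o, 'm, 'x, 'y) over \<Rightarrow>
    ('o, 'm, 'x, 'y) over \<Rightarrow> ('o \<Rightarrow> 'x \<Rightarrow> 'x) \<Rightarrow> bool" where
  "is_over_map C X Y \<eta> \<longleftrightarrow>
     is_natural C (fst X) (fst Y) \<eta> \<and>
     (\<forall>x\<in>Obj C. \<forall>s\<in>Sec (fst X) x. snd Y x (\<eta> x s) = snd X x s)"

definition comma_category :: "('o, 'm) category \<Rightarrow> ('o, 'm, 'y) presheaf \<Rightarrow>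
    (('o, 'm, 'x, 'y) over, ('o, 'm, 'x, 'y) over_map) category" where
  "comma_category C B =
     \<lparr>Obj = {X. is_over C B X},
      Arr = {(X, \<eta>, Y). is_over C B X \<and> is_over C B Y \<and> is_over_map C X Y \<eta>},
      Dom = fst,
      Cod = snd \<circ> snd,
      Ide = (\<lambda>X. (X, \<lambda>x\<in>Obj C. \<lambda>s\<in>Sec (fst X) x. s, X)),
      Cmp = (\<lambda>(Y, \<theta>, Z) (X, \<eta>, Y'). (X, \<lambda>x\<in>Obj C. compose (Sec (fst X) x) (\<theta> x) (\<eta> x), Z))\<rparr>"


section \<open>The category of symmetric cubes\<close>

text \<open>\<open>\<epsilon> \<in> {0,1}^n\<close> is a list of length \<open>n\<close>, with \<^term>\<open>False\<close> for 0 and \<^term>\<open>True\<close> for 1.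
  Coordinates are numbered from 1, so the \<open>i\<close>-th coordinate is \<open>\<epsilon> ! (i - 1)\<close>.\<close>

definition cube_vertices :: "nat \<Rightarrow> bool list set" where
  "cube_vertices n = {\<epsilon>. length \<epsilon> = n}"

text \<open>\<open>face_map n i \<alpha> : [n - 1] \<rightarrow> [n]\<close> for \<open>1 \<le> i \<le> n\<close>;
  \<open>symmetry_map n i : [n] \<rightarrow> [n]\<close> for \<open>1 \<le> i < n\<close>.\<close>

definition face_map :: "nat \<Rightarrow> nat \<Rightarrow> bool \<Rightarrow> bool list \<Rightarrow> bool list" where
  "face_map n i \<alpha> = (\<lambda>\<epsilon>\<in>cube_vertices (n - 1). take (i - 1) \<epsilon> @ [\<alpha>] @ drop (i - 1) \<epsilon>)"

definition exchange :: "nat \<Rightarrow> 'a list \<Rightarrow> 'a list" where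
  "exchange i w = w[i - 1 := w ! i, i := w ! (i - 1)]"

definition symmetry_map :: "nat \<Rightarrow> nat \<Rightarrow> bool list \<Rightarrow> bool list" where
  "symmetry_map n i = (\<lambda>\<epsilon>\<in>cube_vertices n. exchange i \<epsilon>)"

inductive is_box_map :: "nat \<Rightarrow> nat \<Rightarrow> (bool list \<Rightarrow> bool list) \<Rightarrow> bool" where
  box_id: "is_box_map n n (\<lambda>\<epsilon>\<in>cube_vertices n. \<epsilon>)"
| box_face: "1 \<le> i \<Longrightarrow> i \<le> n \<Longrightarrow> is_box_map (n - 1) n (face_map n i \<alpha>)"
| box_symmetry: "1 \<le> i \<Longrightarrow> i < n \<Longrightarrow> is_box_map n n (symmetry_map n i)"
| box_comp: "is_box_map m n f \<Longrightarrow> is_box_map n p g \<Longrightarrow>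
    is_box_map m p (compose (cube_vertices m) g f)"

type_synonym box_arrow = "nat \<times> (bool list \<Rightarrow> bool list) \<times> nat"

text \<open>The object \<open>[n]\<close> is represented by the number \<open>n\<close>.\<close>

definition box_category :: "(nat, box_arrow) category" where
  "box_category =
     \<lparr>Obj = UNIV,
      Arr = {(m, f, n). is_box_map m n f},
      Dom = fst,
      Cod = snd \<circ> snd,
      Ide = (\<lambda>n. (n, \<lambda>\<epsilon>\<in>cube_vertices n. \<epsilon>, n)),
      Cmp = (\<lambda>(n, g, p) (m, f, n'). (m, compose (cube_vertices m) g f, p))\<rparr>"


section \<open>Labelled symmetric precubical sets\<close>

definition words :: "'s set \<Rightarrow> nat \<Rightarrow> 's list set" where
  "words \<Sigma> n = {w. set w \<subseteq> \<Sigma> \<and> length w = n}"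

text \<open>The values on faces and symmetries determine a presheaf because these maps generate the
  cube category; existence and uniqueness are \<open>ex1_label_presheaf\<close> below.\<close>

definition is_label_presheaf :: "'s set \<Rightarrow> (nat, box_arrow, 's list) presheaf \<Rightarrow> bool" where
  "is_label_presheaf \<Sigma> K \<longleftrightarrow>
     is_presheaf box_category K \<and>
     (\<forall>n. Sec K n = words \<Sigma> n) \<and>
     (\<forall>n i \<alpha>. 1 \<le> i \<longrightarrow> i \<le> n \<longrightarrow>
        (\<forall>w\<in>words \<Sigma> n. Res K (n - 1, face_map n i \<alpha>, n) w = take (i - 1) w @ drop i w)) \<and>
     (\<forall>n i. 1 \<le> i \<longrightarrow> i < n \<longrightarrow>
        (\<forall>w\<in>words \<Sigma> n. Res K (n, symmetry_map n i, n) w = exchange i w))"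

definition label_presheaf :: "'s set \<Rightarrow> (nat, box_arrow, 's list) presheaf" where
  "label_presheaf \<Sigma> = (THE K. is_label_presheaf \<Sigma> K)"

text \<open>The comma category contains the labelled symmetric precubical sets whose cubes are elements of
  \<^typ>\<open>'x\<close>. The labelled cubes live in the instance where \<^typ>\<open>'x\<close> is the type of arrows of the
  cube category.\<close>

abbreviation labelled_precubical_sets :: "'s set \<Rightarrow>
    ((nat, box_arrow, 'x, 's list) over, (nat, box_arrow, 'x, 's list) over_map) category" where
  "labelled_precubical_sets \<Sigma> \<equiv> comma_category box_category (label_presheaf \<Sigma>)"

type_synonym 's labelled_box = "(nat, box_arrow, box_arrow, 's list) over"
type_synonym 's labelled_box_map = "(nat, box_arrow, box_arrow, 's list) over_map"

definition labelled_box :: "'s set \<Rightarrow> 's list \<Rightarrow> 's labelled_box" where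
  "labelled_box \<Sigma> as =
     (representable box_category (length as),
      yoneda_map box_category (label_presheaf \<Sigma>) (length as) as)"

definition CUBE_precubical :: "'s set \<Rightarrow> ('s labelled_box, 's labelled_box_map) category" where
  "CUBE_precubical \<Sigma> = full_subcategory (labelled_precubical_sets \<Sigma>) (labelled_box \<Sigma> ` lists \<Sigma>)"


section \<open>Weak higher dimensional transition systems\<close>

record ('x, 'u, 's) hdts =
  States :: "'x set"
  Actions :: "'u set"
  Label :: "'u \<Rightarrow> 's"
  Trans :: "('x \<times> 'u list \<times> 'x) set"

text \<open>An \<open>n\<close>-transition is an element of \<^const>\<open>Trans\<close> whose list of actions has length \<open>n\<close>.\<close>

definition is_whdts :: "'s set \<Rightarrow> ('x, 'u, 's) hdts \<Rightarrow> bool" where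
  "is_whdts \<Sigma> X \<longleftrightarrow>
     Label X \<in> Actions X \<rightarrow>\<^sub>E \<Sigma> \<and>
     (\<forall>(\<alpha>, us, \<beta>) \<in> Trans X.
        \<alpha> \<in> States X \<and> \<beta> \<in> States X \<and> length us \<ge> 1 \<and> us \<in> lists (Actions X)) \<and>
     \<comment> \<open>multiset axiom\<close>
     (\<forall>n \<sigma> \<alpha> us \<beta>. n \<ge> 2 \<longrightarrow> length us = n \<longrightarrow> \<sigma> permutes {..<n} \<longrightarrow>
        (\<alpha>, us, \<beta>) \<in> Trans X \<longrightarrow> (\<alpha>, permute_list \<sigma> us, \<beta>) \<in> Trans X) \<and>
     \<comment> \<open>coherence axiom\<close>
     (\<forall>n p q \<alpha> us \<beta> \<nu>1 \<nu>2. n \<ge> 3 \<longrightarrow> p \<ge> 1 \<longrightarrow> q \<ge> 1 \<longrightarrow> p + q < n \<longrightarrow> length us = n \<longrightarrow>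
        (\<alpha>, us, \<beta>) \<in> Trans X \<longrightarrow>
        (\<alpha>, take p us, \<nu>1) \<in> Trans X \<longrightarrow> (\<nu>1, drop p us, \<beta>) \<in> Trans X \<longrightarrow>
        (\<alpha>, take (p + q) us, \<nu>2) \<in> Trans X \<longrightarrow> (\<nu>2, drop (p + q) us, \<beta>) \<in> Trans X \<longrightarrow>
        (\<nu>1, take q (drop p us), \<nu>2) \<in> Trans X)"

definition is_hdts_map ::
  "('x, 'u, 's) hdts \<Rightarrow> ('y, 'v, 's) hdts \<Rightarrow> ('x \<Rightarrow> 'y) \<times> ('u \<Rightarrow> 'v) \<Rightarrow> bool" where
  "is_hdts_map X Y f \<longleftrightarrow>
     fst f \<in> States X \<rightarrow>\<^sub>E States Y \<and>
     snd f \<in> Actions X \<rightarrow>\<^sub>E Actions Y \<and>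
     (\<forall>u\<in>Actions X. Label Y (snd f u) = Label X u) \<and>
     (\<forall>(\<alpha>, us, \<beta>) \<in> Trans X. (fst f \<alpha>, map (snd f) us, fst f \<beta>) \<in> Trans Y)"

type_synonym ('x, 'u, 's) hdts_map =
  "('x, 'u, 's) hdts \<times> (('x \<Rightarrow> 'x) \<times> ('u \<Rightarrow> 'u)) \<times> ('x, 'u, 's) hdts"

definition WHDTS :: "'s set \<Rightarrow> (('x, 'u, 's) hdts, ('x, 'u, 's) hdts_map) category" where
  "WHDTS \<Sigma> =
     \<lparr>Obj = {X. is_whdts \<Sigma> X},
      Arr = {(X, f, Y). is_whdts \<Sigma> X \<and> is_whdts \<Sigma> Y \<and> is_hdts_map X Y f},
      Dom = fst,
      Cod = snd \<circ> snd,
      Ide = (\<lambda>X. (X, (\<lambda>\<alpha>\<in>States X. \<alpha>, \<lambda>u\<in>Actions X. u), X)),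
      Cmp = (\<lambda>(Y, g, Z) (X, f, Y').
        (X, (compose (States X) (fst g) (fst f), compose (Actions X) (snd g) (snd f)), Z))\<rparr>"

definition cube_action :: "'s list \<Rightarrow> nat \<Rightarrow> 's \<times> nat" where
  "cube_action as i = (as ! (i - 1), i)"

definition hdts_cube :: "'s list \<Rightarrow> (bool list, 's \<times> nat, 's) hdts" where
  "hdts_cube as =
     \<lparr>States = cube_vertices (length as),
      Actions = cube_action as ` {1..length as},
      Label = (\<lambda>u\<in>cube_action as ` {1..length as}. fst u),
      Trans = {(\<epsilon>, map (cube_action as) is, \<epsilon>') | \<epsilon> is \<epsilon>'.
        \<epsilon> \<in> cube_vertices (length as) \<and> \<epsilon>' \<in> cube_vertices (length as) \<and>
        length is \<ge> 1 \<and> distinct is \<and> set is \<subseteq> {1..length as} \<and>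
        (\<forall>i\<in>{1..length as}. \<epsilon> ! (i - 1) \<le> \<epsilon>' ! (i - 1)) \<and>
        (\<forall>i\<in>{1..length as}. \<epsilon> ! (i - 1) \<noteq> \<epsilon>' ! (i - 1) \<longleftrightarrow> i \<in> set is)}\<rparr>"

definition CUBE_WHDTS :: "'s set \<Rightarrow>
    ((bool list, 's \<times> nat, 's) hdts, (bool list, 's \<times> nat, 's) hdts_map) category" where
  "CUBE_WHDTS \<Sigma> = full_subcategory (WHDTS \<Sigma>) (hdts_cube ` lists \<Sigma>)"


section \<open>The functor\<close>

text \<open>The indices \<open>{1..m} \<union> {-\<infinity>, +\<infinity>}\<close> are encoded as \<^const>\<open>Fin\<close>, \<^const>\<open>Minf\<close>, \<^const>\<open>Pinf\<close>.\<close>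

fun coordinate :: "bool list \<Rightarrow> nat extended \<Rightarrow> bool" where
  "coordinate \<epsilon> (Fin i) = \<epsilon> ! (i - 1)"
| "coordinate \<epsilon> Minf = False"
| "coordinate \<epsilon> Pinf = True"

definition is_hat :: "nat \<Rightarrow> nat \<Rightarrow> (bool list \<Rightarrow> bool list) \<Rightarrow> (nat \<Rightarrow> nat extended) \<Rightarrow> bool" where
  "is_hat m n f h \<longleftrightarrow>
     h \<in> {1..n} \<rightarrow>\<^sub>E Fin ` {1..m} \<union> {Minf, Pinf} \<and>
     (\<forall>\<epsilon>\<in>cube_vertices m. f \<epsilon> = map (\<lambda>j. coordinate \<epsilon> (h j)) [1..<n + 1])"

definition hat :: "nat \<Rightarrow> nat \<Rightarrow> (bool list \<Rightarrow> bool list) \<Rightarrow> nat \<Rightarrow> nat extended" where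
  "hat m n f = (THE h. is_hat m n f h)"

text \<open>\<open>bar_inv m n f\<close> is the inverse of the bijection that \<^term>\<open>hat m n f\<close> restricts to;
  see \<open>ex1_hat\<close> and \<open>ex1_bar_inv\<close> below.\<close>

definition bar_inv :: "nat \<Rightarrow> nat \<Rightarrow> (bool list \<Rightarrow> bool list) \<Rightarrow> nat \<Rightarrow> nat" where
  "bar_inv m n f i = (THE j. j \<in> {1..n} \<and> hat m n f j = Fin i)"

text \<open>The word \<open>a\<^sub>1\<dots>a\<^sub>n\<close> of a labelled cube; it is unique, see \<open>box_word_labelled_box\<close> below.\<close>

definition box_word :: "'s set \<Rightarrow> 's labelled_box \<Rightarrow> 's list" where
  "box_word \<Sigma> X = (THE as. as \<in> lists \<Sigma> \<and> X = labelled_box \<Sigma> as)"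

definition T_obj :: "'s set \<Rightarrow> 's labelled_box \<Rightarrow> (bool list, 's \<times> nat, 's) hdts" where
  "T_obj \<Sigma> X = hdts_cube (box_word \<Sigma> X)"

text \<open>The map \<open>[m] \<rightarrow> [n]\<close> underlying a map of presheaves represented by \<open>[m]\<close> and \<open>[n]\<close>:
  the image of the identity of \<open>[m]\<close>.\<close>

definition underlying_map :: "nat \<Rightarrow> (nat \<Rightarrow> box_arrow \<Rightarrow> box_arrow) \<Rightarrow> bool list \<Rightarrow> bool list" where
  "underlying_map m \<eta> = fst (snd (\<eta> m (Ide box_category m)))"

definition T_map :: "'s list \<Rightarrow> 's list \<Rightarrow> (bool list \<Rightarrow> bool list) \<Rightarrow>
    (bool list \<Rightarrow> bool list) \<times> ('s \<times> nat \<Rightarrow> 's \<times> nat)" where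
  "T_map as bs f0 =
     (f0, \<lambda>(a, i)\<in>Actions (hdts_cube as). (a, bar_inv (length as) (length bs) f0 i))"

definition T_arr :: "'s set \<Rightarrow> 's labelled_box_map \<Rightarrow> (bool list, 's \<times> nat, 's) hdts_map" where
  "T_arr \<Sigma> = (\<lambda>(X, \<eta>, Y).
     (T_obj \<Sigma> X,
      T_map (box_word \<Sigma> X) (box_word \<Sigma> Y) (underlying_map (length (box_word \<Sigma> X)) \<eta>),
      T_obj \<Sigma> Y))"


section \<open>Well-definedness\<close>

lemma box_map_extensional:
  "is_box_map m n f \<Longrightarrow> f \<in> cube_vertices m \<rightarrow>\<^sub>E cube_vertices n"
proof (induction rule: is_box_map.induct)
  case (box_comp m n f p g)
  then show ?case
    by (auto simp: PiE_def Pi_def compose_def extensional_def)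
qed (auto simp: face_map_def symmetry_map_def exchange_def cube_vertices_def split: if_splits)

lemma coordinate_inject:
  assumes x: "x \<in> Fin ` {1..m} \<union> {Minf, Pinf}" and y: "y \<in> Fin ` {1..m} \<union> {Minf, Pinf}"
    and eq: "\<And>\<epsilon>. \<epsilon> \<in> cube_vertices m \<Longrightarrow> coordinate \<epsilon> x = coordinate \<epsilon> y"
  shows "x = y"
proof -
  note eqs = eq[unfolded cube_vertices_def mem_Collect_eq]
  have F: "coordinate (replicate m False) x = coordinate (replicate m False) y"
    and T: "coordinate (replicate m True) x = coordinate (replicate m True) y"
    by (auto intro!: eqs)
  have U: "coordinate ((replicate m False)[k - 1 := True]) x =
      coordinate ((replicate m False)[k - 1 := True]) y" for k
    by (auto intro!: eqs)
  show ?thesis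
  proof (cases x; cases y)
    fix k l assume *: "x = Fin k" "y = Fin l"
    then show ?thesis
      using U[of k] x y by (cases "k = l") (auto simp: nth_list_update split: if_splits)
  qed (use x y F T in auto)
qed

lemma hat_unique:
  assumes "is_hat m n f h" "is_hat m n f h'"
  shows "h = h'"
proof (rule PiE_ext)
  show h: "h \<in> {1..n} \<rightarrow>\<^sub>E Fin ` {1..m} \<union> {Minf, Pinf}"
    and h': "h' \<in> {1..n} \<rightarrow>\<^sub>E Fin ` {1..m} \<union> {Minf, Pinf}"
    using assms by (auto simp: is_hat_def)
  fix j assume j: "j \<in> {1..n}"
  show "h j = h' j"
  proof (rule coordinate_inject)
    show "h j \<in> Fin ` {1..m} \<union> {Minf, Pinf}" "h' j \<in> Fin ` {1..m} \<union> {Minf, Pinf}"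
      using h h' j by (auto dest!: PiE_mem)
    fix \<epsilon> assume "\<epsilon> \<in> cube_vertices m"
    then have "map (\<lambda>j. coordinate \<epsilon> (h j)) [1..<n + 1] = map (\<lambda>j. coordinate \<epsilon> (h' j)) [1..<n + 1]"
      using assms by (simp add: is_hat_def)
    then have "\<forall>k\<in>set [1..<n + 1]. coordinate \<epsilon> (h k) = coordinate \<epsilon> (h' k)"
      by (simp only: map_eq_conv)
    moreover have "j \<in> set [1..<n + 1]" using j by auto
    ultimately show "coordinate \<epsilon> (h j) = coordinate \<epsilon> (h' j)" by blast
  qed
qed

definition is_bijective_hat :: "nat \<Rightarrow> nat \<Rightarrow> (nat \<Rightarrow> nat extended) \<Rightarrow> bool" where
  "is_bijective_hat m n h \<longleftrightarrow> (\<forall>i\<in>{1..m}. \<exists>!j. j \<in> {1..n} \<and> h j = Fin i)"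

lemma is_hatI:
  assumes "h \<in> {1..n} \<rightarrow>\<^sub>E Fin ` {1..m} \<union> {Minf, Pinf}"
    and "\<And>\<epsilon>. length \<epsilon> = m \<Longrightarrow> length (f \<epsilon>) = n"
    and "\<And>\<epsilon> k. length \<epsilon> = m \<Longrightarrow> k < n \<Longrightarrow> f \<epsilon> ! k = coordinate \<epsilon> (h (Suc k))"
  shows "is_hat m n f h"
  unfolding is_hat_def
proof (intro conjI ballI)
  fix \<epsilon> assume "\<epsilon> \<in> cube_vertices m"
  then have "length \<epsilon> = m" by (simp add: cube_vertices_def)
  then show "f \<epsilon> = map (\<lambda>j. coordinate \<epsilon> (h j)) [1..<n + 1]"
    by (intro nth_equalityI) (simp_all add: assms del: upt_Suc)
qed (rule assms(1))

lemma hat_id: "is_hat n n (\<lambda>\<epsilon>\<in>cube_vertices n. \<epsilon>) (\<lambda>j\<in>{1..n}. Fin j)"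
  by (rule is_hatI) (auto simp: cube_vertices_def)

definition face_hat :: "nat \<Rightarrow> nat \<Rightarrow> bool \<Rightarrow> nat \<Rightarrow> nat extended" where
  "face_hat n i \<alpha> = (\<lambda>j\<in>{1..n}. if j < i then Fin j else if j = i then (if \<alpha> then Pinf else Minf)
     else Fin (j - 1))"

lemma hat_face:
  assumes i: "1 \<le> i" "i \<le> n"
  shows "is_hat (n - 1) n (face_map n i \<alpha>) (face_hat n i \<alpha>)"
proof (rule is_hatI)
  show "face_hat n i \<alpha> \<in> {1..n} \<rightarrow>\<^sub>E Fin ` {1..n - 1} \<union> {Minf, Pinf}"
  proof (rule PiE_I)
    fix j assume j: "j \<in> {1..n}"
    consider "j < i" | "j = i" | "i < j" by linarith
    then show "face_hat n i \<alpha> j \<in> Fin ` {1..n - 1} \<union> {Minf, Pinf}"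
      using i j by cases (auto simp: face_hat_def intro!: imageI)
  qed (auto simp: face_hat_def)
  fix \<epsilon> :: "bool list"
  assume e: "length \<epsilon> = n - 1"
  then show "length (face_map n i \<alpha> \<epsilon>) = n"
    using i by (simp add: face_map_def cube_vertices_def)
  fix k assume k: "k < n"
  consider "Suc k < i" | "Suc k = i" | "i < Suc k" by linarith
  then show "face_map n i \<alpha> \<epsilon> ! k = coordinate \<epsilon> (face_hat n i \<alpha> (Suc k))"
    using e i k
    by cases (auto simp: face_map_def cube_vertices_def face_hat_def nth_append nth_Cons')
qed

definition symmetry_hat :: "nat \<Rightarrow> nat \<Rightarrow> nat \<Rightarrow> nat extended" where
  "symmetry_hat n i = (\<lambda>j\<in>{1..n}. Fin (Transposition.transpose i (i + 1) j))"

lemma hat_symmetry: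
  assumes i: "1 \<le> i" "i < n"
  shows "is_hat n n (symmetry_map n i) (symmetry_hat n i)"
proof (rule is_hatI)
  show "symmetry_hat n i \<in> {1..n} \<rightarrow>\<^sub>E Fin ` {1..n} \<union> {Minf, Pinf}"
    using i by (auto simp: symmetry_hat_def Transposition.transpose_def intro!: imageI)
  fix \<epsilon> :: "bool list"
  assume e: "length \<epsilon> = n"
  then show "length (symmetry_map n i \<epsilon>) = n"
    by (simp add: symmetry_map_def cube_vertices_def exchange_def)
  fix k assume k: "k < n"
  consider "Suc k = i" | "k = i" | "Suc k \<noteq> i" "k \<noteq> i" by blast
  then show "symmetry_map n i \<epsilon> ! k = coordinate \<epsilon> (symmetry_hat n i (Suc k))"
    using e i k
    by cases (auto simp: symmetry_map_def cube_vertices_def symmetry_hat_def exchange_def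
        nth_list_update Transposition.transpose_def)
qed

definition comp_hat :: "nat \<Rightarrow> (nat \<Rightarrow> nat extended) \<Rightarrow> (nat \<Rightarrow> nat extended) \<Rightarrow> nat \<Rightarrow> nat extended"
  where
  "comp_hat p hf hg = (\<lambda>j\<in>{1..p}. case hg j of Fin k \<Rightarrow> hf k | Pinf \<Rightarrow> Pinf | Minf \<Rightarrow> Minf)"

lemma hat_comp:
  assumes f: "is_box_map m n f" and hf: "is_hat m n f hf" and hg: "is_hat n p g hg"
  shows "is_hat m p (compose (cube_vertices m) g f) (comp_hat p hf hg)"
  unfolding is_hat_def
proof (intro conjI ballI)
  have hf': "hf k \<in> Fin ` {1..m} \<union> {Minf, Pinf}" if "k \<in> {1..n}" for k
    using hf that by (auto simp: is_hat_def dest!: PiE_mem)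
  have hg': "hg k \<in> Fin ` {1..n} \<union> {Minf, Pinf}" if "k \<in> {1..p}" for k
    using hg that by (auto simp: is_hat_def dest!: PiE_mem)
  show "comp_hat p hf hg \<in> {1..p} \<rightarrow>\<^sub>E Fin ` {1..m} \<union> {Minf, Pinf}"
  proof (rule PiE_I)
    fix j assume j: "j \<in> {1..p}"
    show "comp_hat p hf hg j \<in> Fin ` {1..m} \<union> {Minf, Pinf}"
    proof (cases "hg j")
      case (Fin k)
      then have "k \<in> {1..n}" using hg'[OF j] by auto
      from hf'[OF this] show ?thesis using Fin j by (simp add: comp_hat_def)
    qed (use j in \<open>auto simp: comp_hat_def\<close>)
  qed (auto simp: comp_hat_def)
  fix \<epsilon> assume e: "\<epsilon> \<in> cube_vertices m"
  then have fe: "f \<epsilon> \<in> cube_vertices n"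
    using box_map_extensional[OF f] by auto
  have eq: "coordinate (f \<epsilon>) (hg j) = coordinate \<epsilon> (comp_hat p hf hg j)" if j: "j \<in> {1..p}" for j
  proof (cases "hg j")
    case (Fin k)
    then have "k \<in> {1..n}" using hg'[OF j] by auto
    then have "f \<epsilon> ! (k - 1) = coordinate \<epsilon> (hf k)"
      using hf e by (auto simp: is_hat_def simp del: upt_Suc)
    with Fin j show ?thesis by (simp add: comp_hat_def)
  qed (use j in \<open>auto simp: comp_hat_def\<close>)
  have "g (f \<epsilon>) = map (\<lambda>j. coordinate (f \<epsilon>) (hg j)) [1..<p + 1]"
    using hg fe by (auto simp: is_hat_def simp del: upt_Suc)
  also have "\<dots> = map (\<lambda>j. coordinate \<epsilon> (comp_hat p hf hg j)) [1..<p + 1]"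
    using eq by (auto simp del: upt_Suc)
  finally show "compose (cube_vertices m) g f \<epsilon> =
      map (\<lambda>j. coordinate \<epsilon> (comp_hat p hf hg j)) [1..<p + 1]"
    using e by (simp add: compose_eq)
qed

lemma bijective_hat_comp:
  assumes hg: "hg \<in> {1..p} \<rightarrow>\<^sub>E Fin ` {1..n} \<union> {Minf, Pinf}"
    and "is_bijective_hat m n hf" "is_bijective_hat n p hg"
  shows "is_bijective_hat m p (comp_hat p hf hg)"
  unfolding is_bijective_hat_def
proof
  fix i assume i: "i \<in> {1..m}"
  then have "\<exists>!k. k \<in> {1..n} \<and> hf k = Fin i"
    using assms(2) unfolding is_bijective_hat_def by (rule bspec[rotated])
  then obtain k where k: "k \<in> {1..n} \<and> hf k = Fin i"
      "\<forall>k'. k' \<in> {1..n} \<and> hf k' = Fin i \<longrightarrow> k' = k"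
    unfolding Ex1_def by blast
  have "\<exists>!j. j \<in> {1..p} \<and> hg j = Fin k"
    using k(1)[THEN conjunct1] assms(3) unfolding is_bijective_hat_def by (rule bspec[rotated])
  then obtain j where j: "j \<in> {1..p} \<and> hg j = Fin k"
      "\<forall>j'. j' \<in> {1..p} \<and> hg j' = Fin k \<longrightarrow> j' = j"
    unfolding Ex1_def by blast
  show "\<exists>!j. j \<in> {1..p} \<and> comp_hat p hf hg j = Fin i"
  proof (rule ex1I[of _ j])
    show "j \<in> {1..p} \<and> comp_hat p hf hg j = Fin i"
      using k(1) j(1) by (simp add: comp_hat_def)
    fix j' assume a: "j' \<in> {1..p} \<and> comp_hat p hf hg j' = Fin i"
    then obtain k' where k': "hg j' = Fin k'" "hf k' = Fin i"
      by (auto simp: comp_hat_def split: extended.splits)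
    then have "k' \<in> {1..n}"
      using PiE_mem[OF hg, of j'] a by auto
    then show "j' = j"
      using k(2) k' j(2) a by blast
  qed
qed

lemma bijective_hat_exists:
  "is_box_map m n f \<Longrightarrow> \<exists>h. is_hat m n f h \<and> is_bijective_hat m n h"
proof (induction rule: is_box_map.induct)
  case (box_id n)
  have "\<exists>!j. j \<in> {1..n} \<and> (\<lambda>j\<in>{1..n}. Fin j) j = Fin k" if k: "k \<in> {1..n}" for k
    by (rule ex1I[of _ k]) (use k in \<open>simp_all split: if_splits\<close>)
  then have "is_bijective_hat n n (\<lambda>j\<in>{1..n}. Fin j)"
    unfolding is_bijective_hat_def by (rule ballI)
  with hat_id show ?case by (intro exI conjI)
next
  case (box_face i n \<alpha>)
  have "\<exists>!j. j \<in> {1..n} \<and> face_hat n i \<alpha> j = Fin k" if k: "k \<in> {1..n - 1}" for k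
    by (rule ex1I[of _ "if k < i then k else k + 1"])
      (use k box_face in \<open>auto simp: face_hat_def split: if_splits\<close>)
  then have "is_bijective_hat (n - 1) n (face_hat n i \<alpha>)"
    unfolding is_bijective_hat_def by (rule ballI)
  with hat_face[OF box_face] show ?case by (intro exI conjI)
next
  case (box_symmetry i n)
  have "\<exists>!j. j \<in> {1..n} \<and> symmetry_hat n i j = Fin k" if k: "k \<in> {1..n}" for k
    by (rule ex1I[of _ "Transposition.transpose i (i + 1) k"])
      (use k box_symmetry in \<open>auto simp: symmetry_hat_def Transposition.transpose_def split: if_splits\<close>)
  then have "is_bijective_hat n n (symmetry_hat n i)"
    unfolding is_bijective_hat_def by (rule ballI)
  with hat_symmetry[OF box_symmetry] show ?case by (intro exI conjI)
next
  case (box_comp m n f p g)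
  then obtain hf hg where hf: "is_hat m n f hf" "is_bijective_hat m n hf"
    and hg: "is_hat n p g hg" "is_bijective_hat n p hg" by blast
  have "hg \<in> {1..p} \<rightarrow>\<^sub>E Fin ` {1..n} \<union> {Minf, Pinf}"
    using hg(1) by (simp add: is_hat_def)
  from hat_comp[OF box_comp.hyps(1) hf(1) hg(1)] bijective_hat_comp[OF this hf(2) hg(2)]
  show ?case by blast
qed

theorem ex1_hat:
  assumes "is_box_map m n f"
  shows "\<exists>!h. is_hat m n f h"
proof -
  obtain h where h: "is_hat m n f h"
    using bijective_hat_exists[OF assms] by blast
  show ?thesis
    by (rule ex1I[where a = h], rule h, rule hat_unique[OF _ h])
qed

lemma hat_eqI: "is_hat m n f h \<Longrightarrow> hat m n f = h"
  unfolding hat_def by (rule the_equality, assumption) (rule hat_unique)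

theorem ex1_bar_inv:
  assumes "is_box_map m n f" "i \<in> {1..m}"
  shows "\<exists>!j. j \<in> {1..n} \<and> hat m n f j = Fin i"
proof -
  obtain h where "is_hat m n f h" "is_bijective_hat m n h"
    using bijective_hat_exists[OF assms(1)] by blast
  then show ?thesis
    using assms(2) by (simp add: hat_eqI is_bijective_hat_def)
qed

lemma bar_inv_props:
  assumes "is_box_map m n f" "i \<in> {1..m}"
  shows "bar_inv m n f i \<in> {1..n}" "hat m n f (bar_inv m n f i) = Fin i"
  unfolding bar_inv_def
  by (rule theI'[OF ex1_bar_inv[OF assms], THEN conjunct1],
      rule theI'[OF ex1_bar_inv[OF assms], THEN conjunct2])

lemma bar_inv_eqI:
  assumes "is_box_map m n f" "i \<in> {1..m}" "j \<in> {1..n}" "hat m n f j = Fin i"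
  shows "bar_inv m n f i = j"
  unfolding bar_inv_def by (rule the1_equality[OF ex1_bar_inv[OF assms(1,2)]]) (intro conjI assms)

lemma bar_inv_comp:
  assumes f: "is_box_map m n f" and g: "is_box_map n p g" and i: "i \<in> {1..m}"
  shows "bar_inv m p (compose (cube_vertices m) g f) i = bar_inv n p g (bar_inv m n f i)"
proof (rule bar_inv_eqI[OF box_comp[OF f g] i])
  have h: "is_hat m n f (hat m n f)" "is_hat n p g (hat n p g)"
    unfolding hat_def by (rule theI'[OF ex1_hat[OF f]], rule theI'[OF ex1_hat[OF g]])
  show "bar_inv n p g (bar_inv m n f i) \<in> {1..p}"
    by (intro bar_inv_props f g i)
  then show "hat m p (compose (cube_vertices m) g f) (bar_inv n p g (bar_inv m n f i)) = Fin i"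
    unfolding hat_eqI[OF hat_comp[OF f h]]
    using bar_inv_props(2)[OF f i] bar_inv_props(2)[OF g bar_inv_props(1)[OF f i]]
    by (simp add: comp_hat_def)
qed

lemma bar_inv_id:
  assumes "i \<in> {1..n}"
  shows "bar_inv n n (\<lambda>\<epsilon>\<in>cube_vertices n. \<epsilon>) i = i"
  by (rule bar_inv_eqI[OF box_id]) (use assms in \<open>auto simp: hat_eqI[OF hat_id]\<close>)

lemma bar_inv_face:
  assumes "1 \<le> i" "i \<le> n" "k \<in> {1..n - 1}"
  shows "bar_inv (n - 1) n (face_map n i \<alpha>) k = (if k < i then k else k + 1)"
  by (rule bar_inv_eqI[OF box_face])
    (use assms in \<open>auto simp: hat_eqI[OF hat_face[OF assms(1,2)], simplified] face_hat_def\<close>)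

lemma bar_inv_symmetry:
  assumes "1 \<le> i" "i < n" "k \<in> {1..n}"
  shows "bar_inv n n (symmetry_map n i) k = Transposition.transpose i (i + 1) k"
  by (rule bar_inv_eqI[OF box_symmetry])
    (use assms in \<open>auto simp: hat_eqI[OF hat_symmetry] symmetry_hat_def Transposition.transpose_def\<close>)

definition pull_word :: "nat \<Rightarrow> nat \<Rightarrow> (bool list \<Rightarrow> bool list) \<Rightarrow> 's list \<Rightarrow> 's list" where
  "pull_word m n f w = map (\<lambda>i. w ! (bar_inv m n f i - 1)) [1..<m + 1]"

definition word_presheaf :: "'s set \<Rightarrow> (nat, box_arrow, 's list) presheaf" where
  "word_presheaf \<Sigma> =
     \<lparr>Sec = words \<Sigma>,
      Res = (\<lambda>x\<in>Arr box_category. case x of (m, f, n) \<Rightarrow> \<lambda>w\<in>words \<Sigma> n. pull_word m n f w)\<rparr>"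

lemma pull_word_words:
  assumes "is_box_map m n f" "w \<in> words \<Sigma> n"
  shows "pull_word m n f w \<in> words \<Sigma> m"
proof -
  have "w ! (bar_inv m n f i - 1) \<in> \<Sigma>" if "i \<in> {1..m}" for i
  proof -
    have "bar_inv m n f i - 1 < length w"
      using bar_inv_props(1)[OF assms(1) that] assms(2) by (auto simp: words_def)
    then show ?thesis using assms(2) by (auto simp: words_def)
  qed
  then show ?thesis by (auto simp: words_def pull_word_def simp del: upt_Suc)
qed

lemma pull_word_comp:
  assumes "is_box_map m n f" "is_box_map n p g"
  shows "pull_word m p (compose (cube_vertices m) g f) w = pull_word m n f (pull_word n p g w)"
proof -
  have "w ! (bar_inv m p (compose (cube_vertices m) g f) i - 1) =
      pull_word n p g w ! (bar_inv m n f i - 1)" if "i \<in> {1..m}" for i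
    using bar_inv_comp[OF assms that] bar_inv_props(1)[OF assms(1) that]
    by (auto simp: pull_word_def simp del: upt_Suc)
  then show ?thesis by (auto simp: pull_word_def[of m] simp del: upt_Suc)
qed

lemma word_presheaf_is_label_presheaf: "is_label_presheaf \<Sigma> (word_presheaf \<Sigma>)"
  unfolding is_label_presheaf_def
proof (intro conjI allI impI ballI)
  show "is_presheaf box_category (word_presheaf \<Sigma>)"
    unfolding is_presheaf_def
  proof (intro conjI ballI impI)
    fix x assume "x \<in> Obj box_category"
    show "Res (word_presheaf \<Sigma>) (Ide box_category x) = (\<lambda>s\<in>Sec (word_presheaf \<Sigma>) x. s)"
    proof (rule ext)
      fix w
      show "Res (word_presheaf \<Sigma>) (Ide box_category x) w = (\<lambda>s\<in>Sec (word_presheaf \<Sigma>) x. s) w"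
        by (auto simp: word_presheaf_def box_category_def box_id pull_word_def bar_inv_id words_def
            list_eq_iff_nth_eq simp del: upt_Suc)
    qed
  next
    fix f g :: box_arrow
    assume fg: "f \<in> Arr box_category" "g \<in> Arr box_category"
      "Cod box_category f = Dom box_category g"
    then obtain m n p f' g' where *: "f = (m, f', n)" "g = (n, g', p)" "is_box_map m n f'"
      "is_box_map n p g'"
      by (auto simp: box_category_def)
    show "Res (word_presheaf \<Sigma>) (Cmp box_category g f) =
        compose (Sec (word_presheaf \<Sigma>) (Cod box_category g)) (Res (word_presheaf \<Sigma>) f)
          (Res (word_presheaf \<Sigma>) g)"
    proof (rule ext)
      fix w
      show "Res (word_presheaf \<Sigma>) (Cmp box_category g f) w =
        compose (Sec (word_presheaf \<Sigma>) (Cod box_category g)) (Res (word_presheaf \<Sigma>) f)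
          (Res (word_presheaf \<Sigma>) g) w"
        using * pull_word_words[OF *(4), of w] box_comp[OF *(3,4)]
        by (auto simp: word_presheaf_def box_category_def compose_def[of "words _ _"] pull_word_comp)
    qed
  qed (auto simp: word_presheaf_def box_category_def intro: pull_word_words)
  fix n i :: nat and \<alpha> and w :: "'a list"
  show "Sec (word_presheaf \<Sigma>) n = words \<Sigma> n" by (simp add: word_presheaf_def)
  assume w: "w \<in> words \<Sigma> n" and i: "1 \<le> i"
  {
    assume "i \<le> n"
    then show "Res (word_presheaf \<Sigma>) (n - 1, face_map n i \<alpha>, n) w = take (i - 1) w @ drop i w"
      using w i box_face[OF i \<open>i \<le> n\<close>, of \<alpha>]
      by (auto simp: word_presheaf_def box_category_def pull_word_def bar_inv_face words_def
          list_eq_iff_nth_eq nth_append add.commute simp del: upt_Suc One_nat_def)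
  }
  assume "i < n"
  then show "Res (word_presheaf \<Sigma>) (n, symmetry_map n i, n) w = exchange i w"
    using w i box_symmetry[OF i \<open>i < n\<close>]
    by (auto simp: word_presheaf_def box_category_def pull_word_def bar_inv_symmetry words_def
        list_eq_iff_nth_eq exchange_def nth_list_update Transposition.transpose_def
        simp del: upt_Suc)
qed

lemma label_presheaf_unique:
  assumes K: "is_label_presheaf \<Sigma> K" and L: "is_label_presheaf \<Sigma> L"
  shows "K = L"
proof -
  have P: "is_presheaf box_category K" "is_presheaf box_category L"
    and S: "Sec K n = words \<Sigma> n" "Sec L n = words \<Sigma> n" for n
    using K L unfolding is_label_presheaf_def by simp_all
  have ext: "Res M (m, f, n) \<in> words \<Sigma> n \<rightarrow>\<^sub>E words \<Sigma> m"
    if "is_label_presheaf \<Sigma> M" "is_box_map m n f" for M m n f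
  proof -
    have *: "\<forall>f\<in>Arr box_category. Res M f \<in>
        Sec M (Cod box_category f) \<rightarrow>\<^sub>E Sec M (Dom box_category f)"
      using that(1) unfolding is_label_presheaf_def is_presheaf_def by (elim conjE)
    have S: "\<forall>n. Sec M n = words \<Sigma> n"
      using that(1) unfolding is_label_presheaf_def by (elim conjE)
    have "(m, f, n) \<in> Arr box_category"
      using that(2) by (simp add: box_category_def)
    from bspec[OF * this] show ?thesis
      unfolding S[rule_format] by (simp add: box_category_def)
  qed
  have "Res K (m, f, n) = Res L (m, f, n)" if "is_box_map m n f" for m n f
    using that
  proof (induction rule: is_box_map.induct)
    case (box_id n)
    have "Res M (n, \<lambda>\<epsilon>\<in>cube_vertices n. \<epsilon>, n) = (\<lambda>w\<in>words \<Sigma> n. w)"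
      if "is_label_presheaf \<Sigma> M" for M
    proof -
      have *: "\<forall>x\<in>Obj box_category. Res M (Ide box_category x) = (\<lambda>s\<in>Sec M x. s)"
        using that unfolding is_label_presheaf_def is_presheaf_def by (elim conjE)
      have S: "\<forall>n. Sec M n = words \<Sigma> n"
        using that unfolding is_label_presheaf_def by (elim conjE)
      from *[rule_format, of n] S show ?thesis
        by (simp add: box_category_def)
    qed
    from this[OF K] this[OF L] show ?case by (simp only:)
  next
    case (box_face i n \<alpha>)
    have "Res M (n - 1, face_map n i \<alpha>, n) w = take (i - 1) w @ drop i w"
      if "is_label_presheaf \<Sigma> M" "w \<in> words \<Sigma> n" for M w
      using that box_face unfolding is_label_presheaf_def by blast
    note * = this[OF K] this[OF L]
    have f: "is_box_map (n - 1) n (face_map n i \<alpha>)"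
      using box_face by (rule is_box_map.box_face)
    show ?case
      by (rule PiE_ext[OF ext[OF K f] ext[OF L f]]) (simp only: *)
  next
    case (box_symmetry i n)
    have "Res M (n, symmetry_map n i, n) w = exchange i w"
      if "is_label_presheaf \<Sigma> M" "w \<in> words \<Sigma> n" for M w
      using that box_symmetry unfolding is_label_presheaf_def by blast
    note * = this[OF K] this[OF L]
    have f: "is_box_map n n (symmetry_map n i)"
      using box_symmetry by (rule is_box_map.box_symmetry)
    show ?case
      by (rule PiE_ext[OF ext[OF K f] ext[OF L f]]) (simp only: *)
  next
    case (box_comp m n f p g)
    have "Res M (m, compose (cube_vertices m) g f, p) =
        compose (words \<Sigma> p) (Res M (m, f, n)) (Res M (n, g, p))"
      if "is_label_presheaf \<Sigma> M" for M
    proof -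
      have *: "\<forall>f\<in>Arr box_category. \<forall>g\<in>Arr box_category. Cod box_category f = Dom box_category g \<longrightarrow>
          Res M (Cmp box_category g f) =
          compose (Sec M (Cod box_category g)) (Res M f) (Res M g)"
        using that unfolding is_label_presheaf_def is_presheaf_def by (elim conjE)
      have "\<forall>n. Sec M n = words \<Sigma> n"
        using that unfolding is_label_presheaf_def by (elim conjE)
      with *[rule_format, of "(m, f, n)" "(n, g, p)"] show ?thesis
        using box_comp.hyps by (simp add: box_category_def)
    qed
    from this[OF K] this[OF L] show ?case by (simp only: box_comp.IH)
  qed
  then have "Res K x = Res L x" if "x \<in> Arr box_category" for x
    using that by (auto simp: box_category_def)
  then have "Res K = Res L"
    using P by (auto simp: is_presheaf_def intro: extensionalityI)
  moreover have "Sec K = Sec L" using S by auto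
  ultimately show ?thesis by simp
qed

theorem ex1_label_presheaf: "\<exists>!K. is_label_presheaf \<Sigma> K"
  by (rule ex1I[where a = "word_presheaf \<Sigma>"], rule word_presheaf_is_label_presheaf,
      rule label_presheaf_unique[OF _ word_presheaf_is_label_presheaf])

lemma label_presheaf_eq: "label_presheaf \<Sigma> = word_presheaf \<Sigma>"
  unfolding label_presheaf_def
  by (rule the1_equality[OF ex1_label_presheaf word_presheaf_is_label_presheaf])

lemma labelled_box_inject:
  assumes "as \<in> lists \<Sigma>" "bs \<in> lists \<Sigma>" "labelled_box \<Sigma> as = labelled_box \<Sigma> bs"
  shows "as = bs"
proof -
  let ?n = "length as"
  let ?i = "Ide box_category ?n"
  have i: "?i \<in> hom_set box_category ?n ?n"
    by (simp add: hom_set_def box_category_def box_id)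
  have "Sec (representable box_category ?n) ?n = Sec (representable box_category (length bs)) ?n"
    using assms(3) by (simp add: labelled_box_def)
  with i have "?i \<in> hom_set box_category ?n (length bs)"
    by (simp add: representable_def box_category_def)
  then have n: "length bs = ?n"
    by (simp add: hom_set_def box_category_def)
  have "snd (labelled_box \<Sigma> cs) ?n ?i = cs" if "cs \<in> lists \<Sigma>" "length cs = ?n" for cs
  proof -
    have "is_presheaf box_category (label_presheaf \<Sigma>)" "Sec (label_presheaf \<Sigma>) ?n = words \<Sigma> ?n"
      using word_presheaf_is_label_presheaf[of \<Sigma>]
      by (auto simp: label_presheaf_eq is_label_presheaf_def)
    then have "Res (label_presheaf \<Sigma>) ?i = (\<lambda>w\<in>words \<Sigma> ?n. w)"
      by (simp add: is_presheaf_def box_category_def)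
    moreover have "?n \<in> Obj box_category" by (simp add: box_category_def)
    ultimately show ?thesis
      using i that by (auto simp: labelled_box_def yoneda_map_def words_def lists_eq_set)
  qed
  then show ?thesis using assms n by metis
qed

theorem box_word_labelled_box:
  assumes "as \<in> lists \<Sigma>"
  shows "box_word \<Sigma> (labelled_box \<Sigma> as) = as"
  unfolding box_word_def
proof (rule the_equality)
  show "as \<in> lists \<Sigma> \<and> labelled_box \<Sigma> as = labelled_box \<Sigma> as"
    using assms by (intro conjI refl)
  fix bs assume bs: "bs \<in> lists \<Sigma> \<and> labelled_box \<Sigma> as = labelled_box \<Sigma> bs"
  show "bs = as"
    by (rule labelled_box_inject[OF bs[THEN conjunct1] assms bs[THEN conjunct2, symmetric]])
qed

theorem T_obj_labelled_box: "as \<in> lists \<Sigma> \<Longrightarrow> T_obj \<Sigma> (labelled_box \<Sigma> as) = hdts_cube as"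
  by (simp only: T_obj_def box_word_labelled_box)

end

theory Submission
  imports Defs
begin

text \<open>
  On both sides a map between the cubes of the words \<open>as\<close> (length \<open>m\<close>) and \<open>bs\<close> (length \<open>n\<close>) amounts
  to the same datum: a map \<open>f : [m] \<rightarrow> [n]\<close> of the category of cubes such that pulling the word \<open>bs\<close>
  back along \<open>f\<close> gives \<open>as\<close> (\<open>labelled_box_maps\<close>).

  For labelled precubical sets this is the Yoneda lemma, applied once to the maps between the
  representable presheaves and once to their structure maps to the presheaf of labels
  (\<open>is_over_map_yoneda_map_iff\<close>).

  For transition systems, let \<open>\<phi>\<close> be a map of cubes. It preserves labels, so it sends the \<open>i\<close>-th
  action to the \<open>g i\<close>-th one for some \<open>g : {1..m} \<rightarrow> {1..n}\<close> with \<open>b\<^bsub>g i\<^esub> = a\<^sub>i\<close>. The initial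
  and the final state of a transition of a cube determine its actions up to order: the actions are
  the coordinates that change, each of them once and from 0 to 1. The image of the transition from
  \<open>(0,...,0)\<close> to \<open>(1,...,1)\<close> shows that \<open>g\<close> is injective. The image of the transition from \<open>(0,...,0)\<close>
  to \<open>\<epsilon>\<close> shows that the state map copies the coordinate \<open>i\<close> of \<open>\<epsilon>\<close> to the coordinate \<open>g i\<close>, and is
  constant in the coordinates outside the image of \<open>g\<close> (\<open>hdts_map_cube_eq_T_map\<close>).

  It remains to see that every such coordinate map lies in the category of cubes, that is, is a
  composite of faces and symmetries: faces insert the constant coordinates, and what is left is a
  permutation of coordinates, a product of adjacent transpositions (\<open>is_box_map_iff\<close>). So the state
  map of \<open>\<phi>\<close> is a map of the category of cubes and \<open>\<phi>\<close> is recovered from it; conversely all these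
  maps do preserve transitions (\<open>is_hdts_map_T_map\<close>).

  The functor is thus bijective on objects and on arrows, which makes it an isomorphism of
  categories (\<open>is_isomorphism_of_categoriesI\<close>).
\<close>

section \<open>Isomorphisms of categories\<close>

lemma is_categoryD:
  assumes "is_category C"
  shows "f \<in> Arr C \<Longrightarrow> Dom C f \<in> Obj C" "f \<in> Arr C \<Longrightarrow> Cod C f \<in> Obj C"
    and "x \<in> Obj C \<Longrightarrow> Ide C x \<in> Arr C"
    and "x \<in> Obj C \<Longrightarrow> Dom C (Ide C x) = x" "x \<in> Obj C \<Longrightarrow> Cod C (Ide C x) = x"
    and "f \<in> Arr C \<Longrightarrow> g \<in> Arr C \<Longrightarrow> Cod C f = Dom C g \<Longrightarrow> Cmp C g f \<in> Arr C"
    and "f \<in> Arr C \<Longrightarrow> g \<in> Arr C \<Longrightarrow> Cod C f = Dom C g \<Longrightarrow> Dom C (Cmp C g f) = Dom C f"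
    and "f \<in> Arr C \<Longrightarrow> g \<in> Arr C \<Longrightarrow> Cod C f = Dom C g \<Longrightarrow> Cod C (Cmp C g f) = Cod C g"
    and "f \<in> Arr C \<Longrightarrow> x = Dom C f \<Longrightarrow> Cmp C f (Ide C x) = f"
    and "f \<in> Arr C \<Longrightarrow> x = Cod C f \<Longrightarrow> Cmp C (Ide C x) f = f"
    and "f \<in> Arr C \<Longrightarrow> g \<in> Arr C \<Longrightarrow> h \<in> Arr C \<Longrightarrow> Cod C f = Dom C g \<Longrightarrow> Cod C g = Dom C h \<Longrightarrow>
      Cmp C h (Cmp C g f) = Cmp C (Cmp C h g) f"
  using assms by (simp_all add: is_category_def)

text \<open>The two inverse bijections form a functor, because \<open>(Fo, Fm)\<close> is injective and sends the two
  sides of each equation required of them to the same element of \<open>D\<close>.\<close>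

lemma is_isomorphism_of_categoriesI:
  assumes F: "is_functor C D Fo Fm"
    and o: "bij_betw Fo (Obj C) (Obj D)"
    and m: "bij_betw Fm (Arr C) (Arr D)"
  shows "is_isomorphism_of_categories C D Fo Fm"
proof -
  define Go Gm where "Go = inv_into (Obj C) Fo" and "Gm = inv_into (Arr C) Fm"
  have C: "is_category C" and D: "is_category D"
    using F by (simp_all add: is_functor_def)
  have Go: "Go y \<in> Obj C" "Fo (Go y) = y" if "y \<in> Obj D" for y
    using that o unfolding Go_def bij_betw_def by (metis inv_into_into, metis f_inv_into_f)
  have Gm: "Gm g \<in> Arr C" "Fm (Gm g) = g" if "g \<in> Arr D" for g
    using that m unfolding Gm_def bij_betw_def by (metis inv_into_into, metis f_inv_into_f)
  have GFo: "Go (Fo x) = x" if "x \<in> Obj C" for x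
    using that o by (simp add: Go_def bij_betw_def)
  have GFm: "Gm (Fm f) = f" if "f \<in> Arr C" for f
    using that m by (simp add: Gm_def bij_betw_def)
  have obj: "Dom C f \<in> Obj C" "Cod C f \<in> Obj C" if "f \<in> Arr C" for f
    using C that by (auto simp: is_category_def)
  have FD: "Dom D (Fm f) = Fo (Dom C f)" "Cod D (Fm f) = Fo (Cod C f)" if "f \<in> Arr C" for f
    using F that by (auto simp: is_functor_def)
  have G: "Dom C (Gm g) = Go (Dom D g)" "Cod C (Gm g) = Go (Cod D g)" if "g \<in> Arr D" for g
    using FD[OF Gm(1)[OF that]] Gm(2)[OF that] obj[OF Gm(1)[OF that]] by (metis GFo)+
  have "is_functor D C Go Gm"
    unfolding is_functor_def
  proof (intro conjI ballI impI C D)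
    fix y assume y: "y \<in> Obj D"
    have "Fm (Ide C (Go y)) = Ide D y"
      using F Go[OF y] by (simp add: is_functor_def)
    moreover have "Ide C (Go y) \<in> Arr C"
      using C Go[OF y] by (simp add: is_category_def)
    ultimately show "Gm (Ide D y) = Ide C (Go y)"
      by (metis GFm)
  next
    fix f g assume fg: "f \<in> Arr D" "g \<in> Arr D" "Cod D f = Dom D g"
    then have *: "Cod C (Gm f) = Dom C (Gm g)" by (simp add: G)
    then have "Fm (Cmp C (Gm g) (Gm f)) = Cmp D g f"
      using F fg Gm by (simp add: is_functor_def)
    moreover have "Cmp C (Gm g) (Gm f) \<in> Arr C"
      using C * fg Gm by (simp add: is_category_def)
    ultimately show "Gm (Cmp D g f) = Cmp C (Gm g) (Gm f)"
      by (metis GFm)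
  qed (simp_all add: Go Gm G)
  then show ?thesis
    unfolding is_isomorphism_of_categories_def using F GFo GFm Go Gm by blast
qed

lemma is_category_full_subcategory:
  assumes "is_category C"
  shows "is_category (full_subcategory C P)"
  using assms by (simp add: is_category_def full_subcategory_def)

section \<open>Comma categories of presheaves\<close>

lemma is_naturalI:
  assumes "\<eta> \<in> extensional (Obj C)"
    and "\<And>x. x \<in> Obj C \<Longrightarrow> \<eta> x \<in> Sec K x \<rightarrow>\<^sub>E Sec K' x"
    and "\<And>f s. f \<in> Arr C \<Longrightarrow> s \<in> Sec K (Cod C f) \<Longrightarrow>
      \<eta> (Dom C f) (Res K f s) = Res K' f (\<eta> (Cod C f) s)"
  shows "is_natural C K K' \<eta>"
  using assms by (auto simp: is_natural_def PiE_def)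

lemma is_naturalD:
  assumes "is_natural C K K' \<eta>"
  shows "x \<in> Obj C \<Longrightarrow> \<eta> x \<in> Sec K x \<rightarrow>\<^sub>E Sec K' x"
    and "x \<in> Obj C \<Longrightarrow> s \<in> Sec K x \<Longrightarrow> \<eta> x s \<in> Sec K' x"
    and "\<eta> \<in> extensional (Obj C)"
    and "f \<in> Arr C \<Longrightarrow> s \<in> Sec K (Cod C f) \<Longrightarrow>
      \<eta> (Dom C f) (Res K f s) = Res K' f (\<eta> (Cod C f) s)"
proof -
  show *: "\<eta> x \<in> Sec K x \<rightarrow>\<^sub>E Sec K' x" if "x \<in> Obj C" for x
    using assms that unfolding is_natural_def by blast
  show "x \<in> Obj C \<Longrightarrow> s \<in> Sec K x \<Longrightarrow> \<eta> x s \<in> Sec K' x"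
    using * by blast
qed (use assms in \<open>auto simp: is_natural_def PiE_def\<close>)

lemma is_presheafD:
  assumes "is_presheaf C K"
  shows "f \<in> Arr C \<Longrightarrow> s \<in> Sec K (Cod C f) \<Longrightarrow> Res K f s \<in> Sec K (Dom C f)"
    and "x \<in> Obj C \<Longrightarrow> s \<in> Sec K x \<Longrightarrow> Res K (Ide C x) s = s"
    and "f \<in> Arr C \<Longrightarrow> g \<in> Arr C \<Longrightarrow> Cod C f = Dom C g \<Longrightarrow> s \<in> Sec K (Cod C g) \<Longrightarrow>
      Res K (Cmp C g f) s = Res K f (Res K g s)"
  using assms by (auto simp: is_presheaf_def compose_eq)

lemma is_natural_identity:
  assumes C: "is_category C" and K: "is_presheaf C K"
  shows "is_natural C K K (\<lambda>x\<in>Obj C. \<lambda>s\<in>Sec K x. s)"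
proof (rule is_naturalI)
  fix f s assume f: "f \<in> Arr C" "s \<in> Sec K (Cod C f)"
  then have "Dom C f \<in> Obj C" "Cod C f \<in> Obj C" using C by (auto simp: is_category_def)
  then show "(\<lambda>x\<in>Obj C. \<lambda>s\<in>Sec K x. s) (Dom C f) (Res K f s) =
      Res K f ((\<lambda>x\<in>Obj C. \<lambda>s\<in>Sec K x. s) (Cod C f) s)"
    using f is_presheafD(1)[OF K f] by simp
qed auto

lemma is_natural_compose:
  assumes C: "is_category C" and K: "is_presheaf C K"
    and \<eta>: "is_natural C K K' \<eta>" and \<theta>: "is_natural C K' K'' \<theta>"
  shows "is_natural C K K'' (\<lambda>x\<in>Obj C. compose (Sec K x) (\<theta> x) (\<eta> x))"
proof (rule is_naturalI)
  show "(\<lambda>x\<in>Obj C. compose (Sec K x) (\<theta> x) (\<eta> x)) x \<in> Sec K x \<rightarrow>\<^sub>E Sec K'' x" if "x \<in> Obj C" for x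
    using that is_naturalD(2)[OF \<eta>] is_naturalD(2)[OF \<theta>] by (auto simp: compose_def)
  fix f s assume f: "f \<in> Arr C" "s \<in> Sec K (Cod C f)"
  then have o: "Dom C f \<in> Obj C" "Cod C f \<in> Obj C" using C by (auto simp: is_category_def)
  show "(\<lambda>x\<in>Obj C. compose (Sec K x) (\<theta> x) (\<eta> x)) (Dom C f) (Res K f s) =
      Res K'' f ((\<lambda>x\<in>Obj C. compose (Sec K x) (\<theta> x) (\<eta> x)) (Cod C f) s)"
    using f o is_presheafD(1)[OF K f] is_naturalD(2)[OF \<eta> o(2) f(2)]
    by (simp add: compose_eq is_naturalD(4)[OF \<eta>] is_naturalD(4)[OF \<theta>])
qed auto

lemma is_category_comma_category:
  fixes B :: "('o, 'm, 'y) presheaf"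
  assumes C: "is_category C"
  shows "is_category (comma_category C B ::
    (('o, 'm, 'x, 'y) over, ('o, 'm, 'x, 'y) over_map) category)"
proof -
  let ?D = "comma_category C B :: (('o, 'm, 'x, 'y) over, ('o, 'm, 'x, 'y) over_map) category"
  have I: "is_over_map C X X (\<lambda>x\<in>Obj C. \<lambda>s\<in>Sec (fst X) x. s)" if "is_over C B X"
    for X :: "('o, 'm, 'x, 'y) over"
    using that by (simp add: is_over_map_def is_over_def is_natural_identity[OF C])
  have cmp: "is_over_map C X Z (\<lambda>x\<in>Obj C. compose (Sec (fst X) x) (\<theta> x) (\<eta> x))"
    if "is_over C B X" "is_over_map C X Y \<eta>" "is_over_map C Y Z \<theta>"
    for X Y Z :: "('o, 'm, 'x, 'y) over" and \<eta> \<theta>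
    using that by (auto simp: is_over_map_def is_over_def compose_eq is_naturalD(2)
      intro!: is_natural_compose[OF C])
  have ext: "(\<lambda>x\<in>Obj C. compose (Sec K x) (\<eta> x) ((\<lambda>x\<in>Obj C. \<lambda>s\<in>Sec K x. s) x)) = \<eta>"
      "(\<lambda>x\<in>Obj C. compose (Sec K x) ((\<lambda>x\<in>Obj C. \<lambda>s\<in>Sec K' x. s) x) (\<eta> x)) = \<eta>"
    if \<eta>: "is_natural C K K' \<eta>" for K K' :: "('o, 'm, 'x) presheaf" and \<eta>
    by (intro extensionalityI[OF _ is_naturalD(3)[OF \<eta>]];
        use is_naturalD(1)[OF \<eta>] in \<open>auto simp: PiE_def intro!: compose_Id Id_compose\<close>)+
  show ?thesis
    unfolding is_category_def
  proof (intro conjI ballI impI)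
    fix f g h assume *: "f \<in> Arr ?D" "g \<in> Arr ?D" "h \<in> Arr ?D" "Cod ?D f = Dom ?D g" "Cod ?D g = Dom ?D h"
    then show "Cmp ?D h (Cmp ?D g f) = Cmp ?D (Cmp ?D h g) f"
      by (auto simp: comma_category_def is_over_map_def compose_def is_naturalD(2)
        intro!: restrict_ext)
  qed (use I cmp ext in \<open>auto simp: comma_category_def is_over_map_def\<close>)
qed

section \<open>Maps between representable presheaves\<close>

lemma is_presheaf_representable:
  assumes C: "is_category C"
  shows "is_presheaf C (representable C c)"
  unfolding is_presheaf_def
proof (intro conjI ballI impI)
  fix f assume f: "f \<in> Arr C"
  then show "Res (representable C c) f \<in>
      Sec (representable C c) (Cod C f) \<rightarrow>\<^sub>E Sec (representable C c) (Dom C f)"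
    by (auto simp: representable_def hom_set_def is_categoryD[OF C])
  fix g assume g: "g \<in> Arr C" and fg: "Cod C f = Dom C g"
  show "Res (representable C c) (Cmp C g f) =
      compose (Sec (representable C c) (Cod C g)) (Res (representable C c) f)
        (Res (representable C c) g)"
    using f g fg by (auto simp: representable_def hom_set_def is_categoryD[OF C] compose_def
        intro!: restrict_ext)
next
  fix x assume x: "x \<in> Obj C"
  then show "Res (representable C c) (Ide C x) = (\<lambda>s\<in>Sec (representable C c) x. s)"
    by (auto simp: representable_def hom_set_def is_categoryD[OF C] intro!: restrict_ext)
qed (auto simp: representable_def)

lemma is_natural_yoneda_map:
  assumes C: "is_category C" and K: "is_presheaf C K" and s: "s \<in> Sec K c"
  shows "is_natural C (representable C c) K (yoneda_map C K c s)"
proof (rule is_naturalI)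
  fix f g assume f: "f \<in> Arr C" and g: "g \<in> Sec (representable C c) (Cod C f)"
  have "g \<in> Arr C" "Dom C g = Cod C f" "Cod C g = c"
    using f g by (auto simp: representable_def hom_set_def is_categoryD[OF C])
  then show "yoneda_map C K c s (Dom C f) (Res (representable C c) f g) =
      Res K f (yoneda_map C K c s (Cod C f) g)"
    using f s by (auto simp: yoneda_map_def representable_def hom_set_def is_categoryD[OF C]
        is_presheafD[OF K])
qed (use s in \<open>auto simp: yoneda_map_def representable_def hom_set_def
      dest!: is_presheafD(1)[OF K]\<close>)

text \<open>Yoneda: an element \<open>g : x \<rightarrow> c\<close> of the representable presheaf is the restriction along \<open>g\<close> of
  the identity of \<open>c\<close>, so naturality along \<open>g\<close> forces the value at \<open>g\<close>.\<close>

lemma natural_eq_yoneda_map: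
  assumes C: "is_category C" and c: "c \<in> Obj C" and \<eta>: "is_natural C (representable C c) K \<eta>"
  shows "\<eta> c (Ide C c) \<in> Sec K c" "\<eta> = yoneda_map C K c (\<eta> c (Ide C c))"
proof -
  have i: "Ide C c \<in> Sec (representable C c) c"
    using c by (simp add: representable_def hom_set_def is_categoryD[OF C])
  then show "\<eta> c (Ide C c) \<in> Sec K c" by (rule is_naturalD(2)[OF \<eta> c])
  show "\<eta> = yoneda_map C K c (\<eta> c (Ide C c))"
  proof (rule extensionalityI[OF is_naturalD(3)[OF \<eta>]])
    fix x assume x: "x \<in> Obj C"
    show "\<eta> x = yoneda_map C K c (\<eta> c (Ide C c)) x"
    proof (rule extensionalityI)
      show "\<eta> x \<in> extensional (hom_set C x c)"
        using is_naturalD(1)[OF \<eta> x] x by (simp add: PiE_def representable_def)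
      show "yoneda_map C K c (\<eta> c (Ide C c)) x \<in> extensional (hom_set C x c)"
        using x by (simp add: yoneda_map_def)
      fix g assume g: "g \<in> hom_set C x c"
      then have "g \<in> Arr C" "Dom C g = x" "Cod C g = c" by (auto simp: hom_set_def)
      then show "\<eta> x g = yoneda_map C K c (\<eta> c (Ide C c)) x g"
        using is_naturalD(4)[OF \<eta>, of g "Ide C c"] i x c g
        by (simp add: yoneda_map_def representable_def is_categoryD[OF C])
    qed
  qed (simp add: yoneda_map_def)
qed

lemma yoneda_map_identity:
  assumes C: "is_category C" and K: "is_presheaf C K" and "c \<in> Obj C" "s \<in> Sec K c"
  shows "yoneda_map C K c s c (Ide C c) = s"
  using assms by (simp add: yoneda_map_def hom_set_def is_categoryD[OF C] is_presheafD[OF K])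

lemma yoneda_map_representable_identity:
  assumes C: "is_category C" and c: "c \<in> Obj C"
  shows "yoneda_map C (representable C c) c (Ide C c) =
    (\<lambda>x\<in>Obj C. \<lambda>g\<in>Sec (representable C c) x. g)"
  using natural_eq_yoneda_map(2)[OF C c is_natural_identity[OF C is_presheaf_representable[OF C]]] c
  by (simp add: representable_def hom_set_def is_categoryD[OF C])

lemma yoneda_map_representable_compose:
  assumes C: "is_category C" and f: "f \<in> hom_set C c d" and g: "g \<in> hom_set C d e"
  shows "yoneda_map C (representable C e) c (Cmp C g f) =
    (\<lambda>x\<in>Obj C. compose (Sec (representable C c) x)
      (yoneda_map C (representable C e) d g x) (yoneda_map C (representable C d) c f x))"
proof -
  have "Cmp C (Cmp C g f) k = Cmp C g (Cmp C f k)" "Cmp C f k \<in> hom_set C x d"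
    "Cmp C g f \<in> hom_set C c e" if "k \<in> hom_set C x c" for k x
    using that f g by (auto simp: hom_set_def is_categoryD[OF C])
  then show ?thesis
    using f g by (auto simp: yoneda_map_def representable_def compose_def hom_set_def
        intro!: restrict_ext)
qed

lemma is_over_yoneda_map:
  assumes "is_category C" "is_presheaf C B" "s \<in> Sec B c"
  shows "is_over C B (representable C c, yoneda_map C B c s)"
  using assms by (simp add: is_over_def is_presheaf_representable is_natural_yoneda_map)

text \<open>By Yoneda a map between representables is composition with an arrow \<open>f : c \<rightarrow> d\<close>. Both composites
  to \<open>B\<close> are natural maps out of a representable, hence equal as soon as they agree at the identity
  of \<open>c\<close>, where their values are \<open>Res B f t\<close> and \<open>s\<close>.\<close>

lemma is_over_map_yoneda_map_iff:
  assumes C: "is_category C" and B: "is_presheaf C B"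
    and c: "c \<in> Obj C" and d: "d \<in> Obj C" and s: "s \<in> Sec B c" and t: "t \<in> Sec B d"
  shows "is_over_map C (representable C c, yoneda_map C B c s)
      (representable C d, yoneda_map C B d t) \<eta> \<longleftrightarrow>
    (\<exists>f\<in>hom_set C c d. Res B f t = s \<and> \<eta> = yoneda_map C (representable C d) c f)"
proof -
  have compatible: "(\<forall>x\<in>Obj C. \<forall>g\<in>Sec (representable C c) x.
        yoneda_map C B d t x (yoneda_map C (representable C d) c f x g) = yoneda_map C B c s x g)
      \<longleftrightarrow> Res B f t = s" (is "?L \<longleftrightarrow> _") if f: "f \<in> hom_set C c d" for f
  proof -
    have *: "yoneda_map C B d t x (yoneda_map C (representable C d) c f x g) =
        Res B g (Res B f t)" if "x \<in> Obj C" "g \<in> hom_set C x c" for x g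
      using that f t by (simp add: yoneda_map_def representable_def hom_set_def
          is_categoryD[OF C] is_presheafD[OF B])
    have f': "Res B f t \<in> Sec B c"
      using f t is_presheafD(1)[OF B] by (auto simp: hom_set_def)
    have i: "Ide C c \<in> hom_set C c c" using c by (simp add: hom_set_def is_categoryD[OF C])
    show ?thesis
    proof
      assume ?L
      then have "Res B (Ide C c) (Res B f t) = Res B (Ide C c) s"
        using *[OF c i] c i by (simp add: representable_def yoneda_map_def)
      then show "Res B f t = s" using c f' s by (simp add: is_presheafD[OF B])
    next
      assume "Res B f t = s"
      then show ?L using * by (simp add: representable_def yoneda_map_def)
    qed
  qed
  have R: "is_presheaf C (representable C d)" by (rule is_presheaf_representable[OF C])
  have S: "Sec (representable C d) c = hom_set C c d" using c by (simp add: representable_def)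
  show ?thesis
  proof
    assume \<eta>: "is_over_map C (representable C c, yoneda_map C B c s)
      (representable C d, yoneda_map C B d t) \<eta>"
    then have n: "is_natural C (representable C c) (representable C d) \<eta>"
      by (simp add: is_over_map_def)
    define f where "f = \<eta> c (Ide C c)"
    have f: "f \<in> hom_set C c d" "\<eta> = yoneda_map C (representable C d) c f"
      using natural_eq_yoneda_map[OF C c n] by (simp_all add: f_def S)
    moreover have "Res B f t = s"
      using \<eta> compatible[OF f(1)] by (simp add: is_over_map_def f(2))
    ultimately show "\<exists>f\<in>hom_set C c d. Res B f t = s \<and> \<eta> = yoneda_map C (representable C d) c f"
      by blast
  next
    assume "\<exists>f\<in>hom_set C c d. Res B f t = s \<and> \<eta> = yoneda_map C (representable C d) c f"
    then obtain f where f: "f \<in> hom_set C c d" "Res B f t = s"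
      and \<eta>: "\<eta> = yoneda_map C (representable C d) c f" by blast
    show "is_over_map C (representable C c, yoneda_map C B c s)
      (representable C d, yoneda_map C B d t) \<eta>"
      using compatible[OF f(1)] f is_natural_yoneda_map[OF C R, of f c]
      by (simp add: is_over_map_def \<eta> S)
  qed
qed

section \<open>Maps of cubes and their coordinates\<close>

lemma is_category_box_category: "is_category box_category"
proof -
  have id: "compose (cube_vertices m) f (\<lambda>\<epsilon>\<in>cube_vertices m. \<epsilon>) = f"
    "compose (cube_vertices m) (\<lambda>\<epsilon>\<in>cube_vertices n. \<epsilon>) f = f" if "is_box_map m n f" for m n f
    using box_map_extensional[OF that] by (auto simp: PiE_def intro!: compose_Id Id_compose)
  have assoc: "compose (cube_vertices m) h (compose (cube_vertices m) g f) =
      compose (cube_vertices m) (compose (cube_vertices n) h g) f"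
    if "is_box_map m n f" for m n f g h
    using box_map_extensional[OF that] by (auto simp: compose_def intro!: restrict_ext)
  show ?thesis
    by (auto simp: is_category_def box_category_def id assoc
        intro: is_box_map.box_id is_box_map.box_comp)
qed

definition box_map_of_hat :: "nat \<Rightarrow> nat \<Rightarrow> (nat \<Rightarrow> nat extended) \<Rightarrow> bool list \<Rightarrow> bool list" where
  "box_map_of_hat m n h = (\<lambda>\<epsilon>\<in>cube_vertices m. map (\<lambda>j. coordinate \<epsilon> (h j)) [1..<n + 1])"

lemma box_map_of_hat_unique:
  assumes "f \<in> extensional (cube_vertices m)" "is_hat m n f h"
  shows "f = box_map_of_hat m n h"
  using assms by (auto simp: is_hat_def box_map_of_hat_def extensional_def)

text \<open>The coordinates are numbered from 1 and lists from 0; the two shifts cancel.\<close>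

lemma coordinate_map:
  assumes "k \<in> {1..n}"
  shows "coordinate (map u [1..<n + 1]) (Fin k) = u k"
  using assms by (auto simp del: upt_Suc)

text \<open>Composition substitutes one coordinate description into the other, the constants being kept.
  This concerns coordinate maps that are not yet known to lie in the category of cubes.\<close>

lemma box_map_of_hat_compose:
  assumes "h \<in> {1..n} \<rightarrow> Fin ` {1..m} \<union> {Minf, Pinf}"
  shows "compose (cube_vertices l) (box_map_of_hat m n h) (box_map_of_hat l m k) =
    box_map_of_hat l n (\<lambda>j. case h j of Fin i \<Rightarrow> k i | Pinf \<Rightarrow> Pinf | Minf \<Rightarrow> Minf)"
proof (rule extensionalityI[of _ "cube_vertices l"])
  fix \<epsilon> assume e: "\<epsilon> \<in> cube_vertices l"
  have "coordinate (map (\<lambda>i. coordinate \<epsilon> (k i)) [1..<m + 1]) (h j) =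
      coordinate \<epsilon> (case h j of Fin i \<Rightarrow> k i | Pinf \<Rightarrow> Pinf | Minf \<Rightarrow> Minf)" if "j \<in> {1..n}" for j
    using assms that by (auto simp: coordinate_map simp del: upt_Suc split: extended.split dest!: funcset_mem)
  then show "compose (cube_vertices l) (box_map_of_hat m n h) (box_map_of_hat l m k) \<epsilon> =
    box_map_of_hat l n (\<lambda>j. case h j of Fin i \<Rightarrow> k i | Pinf \<Rightarrow> Pinf | Minf \<Rightarrow> Minf) \<epsilon>"
    using e by (auto simp: box_map_of_hat_def compose_eq cube_vertices_def simp del: upt_Suc)
qed (auto simp: box_map_of_hat_def)

lemma box_map_of_hat_cong:
  assumes "\<And>j. j \<in> {1..n} \<Longrightarrow> h j = k j"
  shows "box_map_of_hat m n h = box_map_of_hat m n k"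
  using assms by (auto simp: box_map_of_hat_def simp del: upt_Suc intro!: restrict_ext)

lemma face_map_eq_box_map_of_hat:
  assumes "1 \<le> i" "i \<le> n"
  shows "face_map n i \<alpha> = box_map_of_hat (n - 1) n (face_hat n i \<alpha>)"
  by (rule box_map_of_hat_unique[OF _ hat_face[OF assms]]) (simp add: face_map_def)

lemma symmetry_map_eq_box_map_of_hat:
  assumes "1 \<le> i" "i < n"
  shows "symmetry_map n i = box_map_of_hat n n (symmetry_hat n i)"
  by (rule box_map_of_hat_unique[OF _ hat_symmetry[OF assms]]) (simp add: symmetry_map_def)

text \<open>Permutations of indices act contravariantly: the map of \<open>q \<circ> p\<close> applies the map of \<open>q\<close> first.\<close>

lemma is_box_map_permutation_comp:
  assumes p: "p ` {1..n} \<subseteq> {1..n}"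
    and "is_box_map n n (box_map_of_hat n n (\<lambda>j. Fin (p j)))"
    and "is_box_map n n (box_map_of_hat n n (\<lambda>j. Fin (q j)))"
  shows "is_box_map n n (box_map_of_hat n n (\<lambda>j. Fin (q (p j))))"
proof -
  have "(\<lambda>j. Fin (p j)) \<in> {1..n} \<rightarrow> Fin ` {1..n} \<union> {Minf, Pinf}"
    using p by auto
  from box_map_of_hat_compose[OF this, of n "\<lambda>j. Fin (q j)"] box_comp[OF assms(3,2)]
  show ?thesis by simp
qed

lemma is_box_map_identity: "is_box_map n n (box_map_of_hat n n Fin)"
proof -
  have "(\<lambda>\<epsilon>\<in>cube_vertices n. \<epsilon>) = box_map_of_hat n n (\<lambda>j\<in>{1..n}. Fin j)"
    by (rule box_map_of_hat_unique[OF _ hat_id]) simp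
  also have "\<dots> = box_map_of_hat n n Fin"
    by (rule box_map_of_hat_cong) simp
  finally show ?thesis using box_id[of n] by simp
qed

text \<open>The symmetry maps are the adjacent transpositions. The others arise from them by conjugation:
  for \<open>c = b - 1 > a\<close> the transposition of \<open>a\<close> and \<open>b\<close> is \<open>(c b) \<circ> (a c) \<circ> (c b)\<close>.\<close>

lemma is_box_map_transposition:
  assumes "1 \<le> a" "a < b" "b \<le> n"
  shows "is_box_map n n (box_map_of_hat n n (\<lambda>j. Fin (Transposition.transpose a b j)))"
  using assms
proof (induction "b - a" arbitrary: b)
  case 0
  then show ?case by simp
next
  case (Suc d)
  have adj: "is_box_map n n (box_map_of_hat n n (\<lambda>j. Fin (Transposition.transpose i (i + 1) j)))"
    if "1 \<le> i" "i < n" for i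
  proof -
    have "symmetry_map n i = box_map_of_hat n n (\<lambda>j. Fin (Transposition.transpose i (i + 1) j))"
      unfolding symmetry_map_eq_box_map_of_hat[OF that]
      by (rule box_map_of_hat_cong) (simp add: symmetry_hat_def)
    then show ?thesis using box_symmetry[OF that] by simp
  qed
  show ?case
  proof (cases "b = a + 1")
    case True
    then show ?thesis using adj[of a] Suc.prems by simp
  next
    case False
    define c where "c = b - 1"
    have c: "b = c + 1" "a < c" "c < n" using False Suc.prems by (auto simp: c_def)
    let ?s = "Transposition.transpose c (c + 1)" and ?t = "Transposition.transpose a c"
    have t: "is_box_map n n (box_map_of_hat n n (\<lambda>j. Fin (?t j)))"
      using Suc c by (intro Suc.hyps(1)) auto
    have s: "is_box_map n n (box_map_of_hat n n (\<lambda>j. Fin (?s j)))"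
      using c by (intro adj) auto
    have im: "?s ` {1..n} \<subseteq> {1..n}" "?t ` {1..n} \<subseteq> {1..n}"
      using c Suc.prems by (auto simp: Transposition.transpose_def)
    have *: "is_box_map n n (box_map_of_hat n n (\<lambda>j. Fin (?s (?t (?s j)))))"
      using is_box_map_permutation_comp[OF im(1) s is_box_map_permutation_comp[OF im(2) t s]] .
    have "?s (?t (?s j)) = Transposition.transpose a b j" for j
      using c by (auto simp: Transposition.transpose_def)
    with * show ?thesis by simp
  qed
qed

lemma is_box_map_permutation:
  assumes "p permutes {1..n}"
  shows "is_box_map n n (box_map_of_hat n n (\<lambda>j. Fin (p j)))"
  using assms finite_atLeastAtMost
proof (induction rule: permutes_induct)
  case id
  show ?case using is_box_map_identity[of n] by simp
next
  case (swap a b p)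
  have "is_box_map n n (box_map_of_hat n n (\<lambda>j. Fin (Transposition.transpose a b j)))"
  proof (cases "a < b")
    case True
    then show ?thesis using is_box_map_transposition[of a b n] swap.hyps by simp
  next
    case False
    then show ?thesis
      using is_box_map_transposition[of b a n] swap.hyps by (simp add: transpose_commute)
  qed
  then show ?case
    using is_box_map_permutation_comp[of p n "Transposition.transpose a b"] swap
    by (simp add: comp_def permutes_image)
qed

text \<open>If some coordinate \<open>i\<close> of the target is constant, the map factors through the \<open>i\<close>-th face, which
  leaves a map to a cube of smaller dimension. If no coordinate is constant, the coordinates are
  only permuted.\<close>

lemma is_box_map_box_map_of_hat:
  assumes "h \<in> {1..n} \<rightarrow> Fin ` {1..m} \<union> {Minf, Pinf}" "is_bijective_hat m n h"
  shows "is_box_map m n (box_map_of_hat m n h)"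
  using assms
proof (induction n arbitrary: h)
  case 0
  have "m = 0"
  proof (rule ccontr)
    assume "m \<noteq> 0"
    then have "1 \<in> {1..m}" by simp
    with 0(2) show False by (auto simp: is_bijective_hat_def)
  qed
  moreover have "box_map_of_hat 0 0 h = box_map_of_hat 0 0 Fin"
    by (rule box_map_of_hat_cong) simp
  ultimately show ?case using is_box_map_identity[of 0] by simp
next
  case (Suc n)
  let ?N = "Suc n"
  show ?case
  proof (cases "\<exists>i\<in>{1..?N}. h i \<in> {Minf, Pinf}")
    case True
    then obtain i where i: "1 \<le> i" "i \<le> ?N" "h i \<in> {Minf, Pinf}" by auto
    define \<alpha> where "\<alpha> = (h i = Pinf)"
    \<comment> \<open>\<open>skip\<close> numbers the coordinates other than \<open>i\<close>\<close>
    define skip where "skip j = (if j < i then j else j + 1)" for j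
    have skip: "skip j \<in> {1..?N}" if "j \<in> {1..n}" for j
      using that by (auto simp: skip_def)
    have skip_surj: "\<exists>j'\<in>{1..n}. j = skip j'" if "j \<in> {1..?N}" "j \<noteq> i" for j
      using that i by (intro bexI[of _ "if j < i then j else j - 1"]) (auto simp: skip_def)
    have skip_inj: "skip j = skip j' \<longleftrightarrow> j = j'" for j j'
      by (auto simp: skip_def split: if_splits)
    have "is_box_map m n (box_map_of_hat m n (h \<circ> skip))"
    proof (rule Suc.IH)
      show "h \<circ> skip \<in> {1..n} \<rightarrow> Fin ` {1..m} \<union> {Minf, Pinf}"
        using Suc.prems(1) skip unfolding Pi_iff o_def by blast
      show "is_bijective_hat m n (h \<circ> skip)"
        unfolding is_bijective_hat_def
      proof
        fix k assume "k \<in> {1..m}"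
        then obtain j where j: "j \<in> {1..?N}" "h j = Fin k"
          and u: "\<And>j'. j' \<in> {1..?N} \<Longrightarrow> h j' = Fin k \<Longrightarrow> j' = j"
          using Suc.prems(2) unfolding is_bijective_hat_def by blast
        have "j \<noteq> i" using i(3) j(2) by auto
        then obtain j' where j': "j' \<in> {1..n}" "j = skip j'"
          using skip_surj[OF j(1)] by blast
        show "\<exists>!j. j \<in> {1..n} \<and> (h \<circ> skip) j = Fin k"
        proof (rule ex1I[of _ j'])
          show "j' \<in> {1..n} \<and> (h \<circ> skip) j' = Fin k" using j j' by simp
          fix l assume "l \<in> {1..n} \<and> (h \<circ> skip) l = Fin k"
          then have "skip l = j" using u[OF skip[of l]] by simp
          then show "l = j'" using j' skip_inj by simp
        qed
      qed
    qed
    moreover have "is_box_map n ?N (face_map ?N i \<alpha>)"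
      using box_face[OF i(1,2)] by simp
    ultimately have *: "is_box_map m ?N (compose (cube_vertices m) (face_map ?N i \<alpha>)
        (box_map_of_hat m n (h \<circ> skip)))"
      by (rule box_comp)
    have fh: "face_hat ?N i \<alpha> \<in> {1..?N} \<rightarrow> Fin ` {1..n} \<union> {Minf, Pinf}"
      using hat_face[OF i(1,2), of \<alpha>] unfolding is_hat_def PiE_def diff_Suc_1 by blast
    have "(case face_hat ?N i \<alpha> j of Fin k \<Rightarrow> (h \<circ> skip) k | Pinf \<Rightarrow> Pinf | Minf \<Rightarrow> Minf) = h j"
      if "j \<in> {1..?N}" for j
      using i that by (cases j i rule: linorder_cases) (auto simp: face_hat_def skip_def \<alpha>_def)
    then have "compose (cube_vertices m) (face_map ?N i \<alpha>) (box_map_of_hat m n (h \<circ> skip)) =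
        box_map_of_hat m ?N h"
      unfolding face_map_eq_box_map_of_hat[OF i(1,2)] diff_Suc_1 box_map_of_hat_compose[OF fh]
      by (rule box_map_of_hat_cong)
    then show ?thesis using * by simp
  next
    case False
    \<comment> \<open>the value outside \<open>{1..?N}\<close> makes \<open>p\<close> a permutation of all natural numbers\<close>
    define p where "p j = (if j \<in> {1..?N} then THE k. h j = Fin k else j)" for j
    have p: "h j = Fin (p j)" "p j \<in> {1..m}" if j: "j \<in> {1..?N}" for j
    proof -
      have "h j \<in> Fin ` {1..m}" using Suc.prems(1) j False by fastforce
      then show "h j = Fin (p j)" "p j \<in> {1..m}" using j by (auto simp: p_def)
    qed
    have bij: "bij_betw p {1..?N} {1..m}"
    proof (rule bij_betw_imageI)
      show "inj_on p {1..?N}"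
      proof (rule inj_onI)
        fix j j' assume "j \<in> {1..?N}" "j' \<in> {1..?N}" "p j = p j'"
        then show "j = j'"
          using p[of j] p[of j'] Suc.prems(2) unfolding is_bijective_hat_def by metis
      qed
      have "k \<in> p ` {1..?N}" if "k \<in> {1..m}" for k
      proof -
        obtain j where "j \<in> {1..?N}" "h j = Fin k"
          using Suc.prems(2) \<open>k \<in> {1..m}\<close> unfolding is_bijective_hat_def by blast
        then show ?thesis using p[of j] by auto
      qed
      then show "p ` {1..?N} = {1..m}" using p(2) by blast
    qed
    then have m: "m = ?N" using bij_betw_same_card by fastforce
    have "p permutes {1..?N}"
      using bij m by (intro bij_imp_permutes) (auto simp: p_def)
    from is_box_map_permutation[OF this]
    show ?thesis
      unfolding m using box_map_of_hat_cong[of ?N h "\<lambda>j. Fin (p j)" ?N] p(1) by simp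
  qed
qed

text \<open>This characterises the category of cubes without reference to its generators: the maps that copy
  every coordinate of the source exactly once and fill up with constants.\<close>

lemma is_box_map_iff:
  "is_box_map m n f \<longleftrightarrow>
    f \<in> extensional (cube_vertices m) \<and> (\<exists>h. is_hat m n f h \<and> is_bijective_hat m n h)"
proof
  assume "f \<in> extensional (cube_vertices m) \<and> (\<exists>h. is_hat m n f h \<and> is_bijective_hat m n h)"
  then obtain h where f: "f \<in> extensional (cube_vertices m)"
    and h: "is_hat m n f h" "is_bijective_hat m n h" by blast
  have "h \<in> {1..n} \<rightarrow> Fin ` {1..m} \<union> {Minf, Pinf}" using h(1) by (auto simp: is_hat_def)
  from is_box_map_box_map_of_hat[OF this h(2)]
  show "is_box_map m n f" unfolding box_map_of_hat_unique[OF f h(1)] .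
qed (use box_map_extensional bijective_hat_exists in \<open>auto simp: PiE_def\<close>)

section \<open>Weak higher dimensional transition systems\<close>

lemma is_hdts_map_compose:
  assumes f: "is_hdts_map X Y f" and g: "is_hdts_map Y Z g"
    and X: "is_whdts \<Sigma> X"
  shows "is_hdts_map X Z (compose (States X) (fst g) (fst f), compose (Actions X) (snd g) (snd f))"
proof -
  have f1: "snd f x \<in> Actions Y" if "x \<in> Actions X" for x
    using f that by (auto simp: is_hdts_map_def)
  have "(compose (States X) (fst g) (fst f) \<alpha>, map (compose (Actions X) (snd g) (snd f)) us,
      compose (States X) (fst g) (fst f) \<beta>) \<in> Trans Z" if t: "(\<alpha>, us, \<beta>) \<in> Trans X" for \<alpha> us \<beta>
  proof -
    have "\<alpha> \<in> States X" "\<beta> \<in> States X" "us \<in> lists (Actions X)"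
      using X t by (auto simp: is_whdts_def)
    moreover from this have "map (compose (Actions X) (snd g) (snd f)) us = map (snd g) (map (snd f) us)"
      by (auto simp: compose_eq lists_eq_set)
    moreover have "(fst f \<alpha>, map (snd f) us, fst f \<beta>) \<in> Trans Y"
      using f t by (auto simp: is_hdts_map_def)
    then have "(fst g (fst f \<alpha>), map (snd g) (map (snd f) us), fst g (fst f \<beta>)) \<in> Trans Z"
      using g unfolding is_hdts_map_def by blast
    ultimately show ?thesis by (simp add: compose_eq del: map_map map_eq_conv)
  qed
  moreover have "Label Z (snd g (snd f u)) = Label X u" if "u \<in> Actions X" for u
    using f g f1[OF that] that unfolding is_hdts_map_def by metis
  moreover have "compose (States X) (fst g) (fst f) \<in> States X \<rightarrow>\<^sub>E States Z"
    "compose (Actions X) (snd g) (snd f) \<in> Actions X \<rightarrow>\<^sub>E Actions Z"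
    using f g by (auto simp: is_hdts_map_def PiE_def Pi_iff compose_eq)
  ultimately show ?thesis
    by (auto simp: is_hdts_map_def compose_eq)
qed

lemma is_category_WHDTS:
  "is_category (WHDTS \<Sigma> :: (('x, 'u, 's) hdts, ('x, 'u, 's) hdts_map) category)"
proof -
  have ide: "is_hdts_map X X (\<lambda>\<alpha>\<in>States X. \<alpha>, \<lambda>u\<in>Actions X. u)" if X: "is_whdts \<Sigma> X"
    for X :: "('x, 'u, 's) hdts"
  proof -
    have "((\<lambda>\<alpha>\<in>States X. \<alpha>) \<alpha>, map (\<lambda>u\<in>Actions X. u) us, (\<lambda>\<alpha>\<in>States X. \<alpha>) \<beta>) \<in> Trans X"
      if t: "(\<alpha>, us, \<beta>) \<in> Trans X" for \<alpha> us \<beta>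
    proof -
      have "\<alpha> \<in> States X" "\<beta> \<in> States X" "us \<in> lists (Actions X)"
        using X t by (auto simp: is_whdts_def)
      moreover from this have "map (\<lambda>u\<in>Actions X. u) us = us"
        by (intro map_idI) (auto simp: lists_eq_set)
      ultimately show ?thesis using t by simp
    qed
    then show ?thesis by (auto simp: is_hdts_map_def restrict_apply' simp del: restrict_apply)
  qed
  have id: "compose (States X) f\<^sub>0 (\<lambda>\<alpha>\<in>States X. \<alpha>) = f\<^sub>0"
    "compose (Actions X) f\<^sub>1 (\<lambda>u\<in>Actions X. u) = f\<^sub>1"
    "compose (States X) (\<lambda>\<alpha>\<in>States Y. \<alpha>) f\<^sub>0 = f\<^sub>0"
    "compose (Actions X) (\<lambda>u\<in>Actions Y. u) f\<^sub>1 = f\<^sub>1" if f: "is_hdts_map X Y (f\<^sub>0, f\<^sub>1)"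
    for X Y :: "('x, 'u, 's) hdts" and f\<^sub>0 f\<^sub>1
    using f by (auto simp: is_hdts_map_def PiE_def intro!: compose_Id Id_compose)
  have assoc: "compose (States X) h (compose (States X) g (fst f)) =
      compose (States X) (compose (States Y) h g) (fst f)"
    "compose (Actions X) h' (compose (Actions X) g' (snd f)) =
      compose (Actions X) (compose (Actions Y) h' g') (snd f)" if f: "is_hdts_map X Y f"
    for X Y :: "('x, 'u, 's) hdts" and f h g h' g'
    using f by (auto simp: is_hdts_map_def compose_def intro!: restrict_ext)
  show ?thesis
    unfolding is_category_def
  proof (intro conjI ballI impI)
    fix f g h :: "('x, 'u, 's) hdts_map"
    assume "f \<in> Arr (WHDTS \<Sigma>)" "g \<in> Arr (WHDTS \<Sigma>)" "h \<in> Arr (WHDTS \<Sigma>)"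
      "Cod (WHDTS \<Sigma>) f = Dom (WHDTS \<Sigma>) g" "Cod (WHDTS \<Sigma>) g = Dom (WHDTS \<Sigma>) h"
    then show "Cmp (WHDTS \<Sigma>) h (Cmp (WHDTS \<Sigma>) g f) = Cmp (WHDTS \<Sigma>) (Cmp (WHDTS \<Sigma>) h g) f"
      by (cases f, cases g, cases h) (auto simp add: WHDTS_def assoc)
  next
    fix f g :: "('x, 'u, 's) hdts_map"
    assume "f \<in> Arr (WHDTS \<Sigma>)" "g \<in> Arr (WHDTS \<Sigma>)" "Cod (WHDTS \<Sigma>) f = Dom (WHDTS \<Sigma>) g"
    then show "Cmp (WHDTS \<Sigma>) g f \<in> Arr (WHDTS \<Sigma>)"
      by (auto simp: WHDTS_def dest: is_hdts_map_compose)
  qed (auto simp: WHDTS_def ide id)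
qed

section \<open>Cubes as transition systems\<close>

lemma inj_cube_action: "inj (cube_action as)"
  by (auto simp: inj_on_def cube_action_def)

text \<open>An action of a cube carries its index, so that the list of indices of a transition can be read
  off from its list of actions.\<close>

lemma Trans_hdts_cube_iff:
  "(\<epsilon>, map (cube_action as) is, \<epsilon>') \<in> Trans (hdts_cube as) \<longleftrightarrow>
    \<epsilon> \<in> cube_vertices (length as) \<and> \<epsilon>' \<in> cube_vertices (length as) \<and>
    is \<noteq> [] \<and> distinct is \<and> set is \<subseteq> {1..length as} \<and>
    (\<forall>i\<in>{1..length as}. \<epsilon> ! (i - 1) \<le> \<epsilon>' ! (i - 1)) \<and>
    (\<forall>i\<in>{1..length as}. \<epsilon> ! (i - 1) \<noteq> \<epsilon>' ! (i - 1) \<longleftrightarrow> i \<in> set is)"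
  unfolding hdts_cube_def hdts.simps mem_Collect_eq prod.inject inj_map_eq_map[OF inj_cube_action]
  by (auto simp: Suc_le_eq)

lemma Trans_hdts_cubeE:
  assumes "t \<in> Trans (hdts_cube as)"
  obtains \<epsilon> "is" \<epsilon>' where "t = (\<epsilon>, map (cube_action as) is, \<epsilon>')"
  using assms by (auto simp: hdts_cube_def)

lemma Label_hdts_cube:
  assumes "i \<in> {1..length as}"
  shows "Label (hdts_cube as) (cube_action as i) = as ! (i - 1)"
  using assms by (simp add: hdts_cube_def) (simp add: cube_action_def)

text \<open>The transitions depend on the set of their indices only, which gives the multiset axiom. For
  the coherence axiom, the coordinates that change from \<open>\<alpha>\<close> to \<open>\<nu>1\<close> are among those that change from
  \<open>\<alpha>\<close> to \<open>\<nu>2\<close>, and every change is from 0 to 1; hence \<open>\<nu>1\<close> and \<open>\<nu>2\<close> differ exactly in the difference of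
  the two index sets.\<close>

lemma is_whdts_hdts_cube:
  assumes "as \<in> lists \<Sigma>"
  shows "is_whdts \<Sigma> (hdts_cube as)"
  unfolding is_whdts_def
proof (intro conjI allI impI ballI)
  show "Label (hdts_cube as) \<in> Actions (hdts_cube as) \<rightarrow>\<^sub>E \<Sigma>"
    using assms by (auto simp: hdts_cube_def cube_action_def lists_eq_set intro!: subsetD[OF _ nth_mem])
next
  fix t assume t: "t \<in> Trans (hdts_cube as)"
  then obtain \<epsilon> "is" \<epsilon>' where *: "t = (\<epsilon>, map (cube_action as) is, \<epsilon>')" by (rule Trans_hdts_cubeE)
  show "case t of (\<alpha>, us, \<beta>) \<Rightarrow> \<alpha> \<in> States (hdts_cube as) \<and> \<beta> \<in> States (hdts_cube as) \<and>
      length us \<ge> 1 \<and> us \<in> lists (Actions (hdts_cube as))"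
    using t unfolding * Trans_hdts_cube_iff
    by (auto simp: hdts_cube_def Suc_le_eq lists_eq_set)
next
  fix n \<sigma> \<alpha> us \<beta>
  assume n: "length us = n" and \<sigma>: "\<sigma> permutes {..<n}" and t: "(\<alpha>, us, \<beta>) \<in> Trans (hdts_cube as)"
  from t obtain "is" where us: "us = map (cube_action as) is" by (auto elim: Trans_hdts_cubeE)
  have \<sigma>': "\<sigma> permutes {..<length is}" using \<sigma> n us by simp
  have "permute_list \<sigma> us = map (cube_action as) (permute_list \<sigma> is)"
    using \<sigma>' by (simp add: us permute_list_map)
  moreover have "permute_list \<sigma> is = [] \<longleftrightarrow> is = []"
    by (metis length_0_conv length_permute_list)
  ultimately show "(\<alpha>, permute_list \<sigma> us, \<beta>) \<in> Trans (hdts_cube as)"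
    using t \<sigma>' by (simp add: us Trans_hdts_cube_iff del: map_map)
next
  fix n p q \<alpha> us \<beta> \<nu>1 \<nu>2
  assume n: "q \<ge> 1" "p + q < n" "length us = n"
    and t: "(\<alpha>, us, \<beta>) \<in> Trans (hdts_cube as)"
    and t1: "(\<alpha>, take p us, \<nu>1) \<in> Trans (hdts_cube as)"
    and t2: "(\<alpha>, take (p + q) us, \<nu>2) \<in> Trans (hdts_cube as)"
  from t obtain "is" where us: "us = map (cube_action as) is" by (auto elim: Trans_hdts_cubeE)
  define ks where "ks = take q (drop p is)"
  have split: "take (p + q) is = take p is @ ks"
    by (simp add: take_add ks_def)
  note T = t[unfolded us Trans_hdts_cube_iff] t1[unfolded us take_map Trans_hdts_cube_iff]
    t2[unfolded us take_map Trans_hdts_cube_iff split]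
  have "ks \<noteq> []" using n by (auto simp: ks_def us)
  have disj: "set (take p is) \<inter> set ks = {}" using T(3) by auto
  have "\<nu>1 ! (i - 1) \<le> \<nu>2 ! (i - 1) \<and> (\<nu>1 ! (i - 1) \<noteq> \<nu>2 ! (i - 1) \<longleftrightarrow> i \<in> set ks)"
    if i: "i \<in> {1..length as}" for i
  proof -
    have "\<alpha> ! (i - 1) \<le> \<nu>1 ! (i - 1)" "\<alpha> ! (i - 1) \<noteq> \<nu>1 ! (i - 1) \<longleftrightarrow> i \<in> set (take p is)"
      "\<alpha> ! (i - 1) \<le> \<nu>2 ! (i - 1)"
      "\<alpha> ! (i - 1) \<noteq> \<nu>2 ! (i - 1) \<longleftrightarrow> i \<in> set (take p is) \<or> i \<in> set ks"
      using T(2,3) i by auto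
    then show ?thesis using disj by auto
  qed
  then have "(\<nu>1, map (cube_action as) ks, \<nu>2) \<in> Trans (hdts_cube as)"
    using T(2,3) \<open>ks \<noteq> []\<close> by (simp add: Trans_hdts_cube_iff)
  then show "(\<nu>1, take q (drop p us), \<nu>2) \<in> Trans (hdts_cube as)"
    by (simp add: us ks_def take_map drop_map)
qed

lemma hdts_cube_inject: "hdts_cube as = hdts_cube bs \<longleftrightarrow> as = bs"
proof
  assume eq: "hdts_cube as = hdts_cube bs"
  have "cube_vertices (length as) = cube_vertices (length bs)"
    using arg_cong[OF eq, of States] by (simp add: hdts_cube_def)
  moreover have "replicate (length as) False \<in> cube_vertices (length as)"
    by (simp add: cube_vertices_def)
  ultimately have l: "length as = length bs" by (simp add: cube_vertices_def)
  show "as = bs"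
  proof (rule nth_equalityI[OF l])
    fix k assume "k < length as"
    then have "cube_action as (Suc k) \<in> Actions (hdts_cube as)"
      by (auto simp: hdts_cube_def)
    then show "as ! k = bs ! k"
      unfolding eq by (auto simp: hdts_cube_def cube_action_def)
  qed
qed simp

lemma hat_props:
  assumes f: "is_box_map m n f"
  shows "is_hat m n f (hat m n f)"
    and "\<epsilon> \<in> cube_vertices m \<Longrightarrow> j \<in> {1..n} \<Longrightarrow> f \<epsilon> ! (j - 1) = coordinate \<epsilon> (hat m n f j)"
proof -
  show h: "is_hat m n f (hat m n f)"
    unfolding hat_def by (rule theI'[OF ex1_hat[OF f]])
  show "f \<epsilon> ! (j - 1) = coordinate \<epsilon> (hat m n f j)" if "\<epsilon> \<in> cube_vertices m" "j \<in> {1..n}"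
    using h that by (auto simp: is_hat_def simp del: upt_Suc)
qed

lemma box_map_at_bar_inv:
  assumes "is_box_map m n f" "\<epsilon> \<in> cube_vertices m" "i \<in> {1..m}"
  shows "f \<epsilon> ! (bar_inv m n f i - 1) = \<epsilon> ! (i - 1)"
  using hat_props(2)[OF assms(1,2) bar_inv_props(1)[OF assms(1,3)]] bar_inv_props(2)[OF assms(1,3)]
  by simp

lemma box_map_off_bar_inv:
  assumes f: "is_box_map m n f" and "\<epsilon> \<in> cube_vertices m" "\<epsilon>' \<in> cube_vertices m"
    and j: "j \<in> {1..n}" "j \<notin> bar_inv m n f ` {1..m}"
  shows "f \<epsilon> ! (j - 1) = f \<epsilon>' ! (j - 1)"
proof (cases "hat m n f j")
  case (Fin i)
  then have "i \<in> {1..m}"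
    using hat_props(1)[OF f] j(1) by (auto simp: is_hat_def dest!: PiE_mem)
  then have "j \<in> bar_inv m n f ` {1..m}"
    using bar_inv_eqI[OF f _ j(1) Fin] by blast
  then show ?thesis using j by simp
qed (use assms hat_props(2)[OF f] in auto)

lemma inj_on_bar_inv:
  assumes "is_box_map m n f"
  shows "inj_on (bar_inv m n f) {1..m}"
  by (rule inj_onI) (metis bar_inv_props(2)[OF assms] extended.inject(1))

lemma pull_word_eq_iff:
  assumes "length as = m"
  shows "pull_word m n f bs = as \<longleftrightarrow> (\<forall>i\<in>{1..m}. bs ! (bar_inv m n f i - 1) = as ! (i - 1))"
proof
  assume "pull_word m n f bs = as"
  then show "\<forall>i\<in>{1..m}. bs ! (bar_inv m n f i - 1) = as ! (i - 1)"
    by (auto simp: pull_word_def simp del: upt_Suc)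
next
  assume *: "\<forall>i\<in>{1..m}. bs ! (bar_inv m n f i - 1) = as ! (i - 1)"
  show "pull_word m n f bs = as"
    by (rule nth_equalityI) (use assms * in \<open>auto simp: pull_word_def simp del: upt_Suc\<close>)
qed

lemma snd_T_map_cube_action:
  assumes "i \<in> {1..length as}" "pull_word (length as) (length bs) f bs = as"
  shows "snd (T_map as bs f) (cube_action as i) = cube_action bs (bar_inv (length as) (length bs) f i)"
proof -
  have "cube_action as i \<in> Actions (hdts_cube as)"
    using assms(1) by (simp add: hdts_cube_def)
  moreover have "bs ! (bar_inv (length as) (length bs) f i - 1) = as ! (i - 1)"
    using assms pull_word_eq_iff by blast
  ultimately show ?thesis by (simp add: T_map_def cube_action_def)
qed

text \<open>A map \<open>f\<close> of the category of cubes copies the coordinate \<open>i\<close> to \<open>bar_inv m n f i\<close> and is constant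
  elsewhere. So if exactly the coordinates of a transition change, exactly their images change after
  \<open>f\<close>, in the same direction.\<close>

lemma is_hdts_map_T_map:
  assumes f: "is_box_map (length as) (length bs) f"
    and w: "pull_word (length as) (length bs) f bs = as"
  shows "is_hdts_map (hdts_cube as) (hdts_cube bs) (T_map as bs f)"
  unfolding is_hdts_map_def
proof (intro conjI ballI)
  let ?m = "length as" and ?n = "length bs"
  let ?g = "bar_inv ?m ?n f"
  note act = snd_T_map_cube_action[OF _ w]
  have g: "?g i \<in> {1..?n}" if "i \<in> {1..?m}" for i
    by (rule bar_inv_props(1)[OF f that])
  show "fst (T_map as bs f) \<in> States (hdts_cube as) \<rightarrow>\<^sub>E States (hdts_cube bs)"
    using box_map_extensional[OF f] by (simp add: T_map_def hdts_cube_def)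
  show "snd (T_map as bs f) \<in> Actions (hdts_cube as) \<rightarrow>\<^sub>E Actions (hdts_cube bs)"
  proof (rule PiE_I)
    fix u assume "u \<in> Actions (hdts_cube as)"
    then obtain i where "i \<in> {1..?m}" "u = cube_action as i" by (auto simp: hdts_cube_def)
    then show "snd (T_map as bs f) u \<in> Actions (hdts_cube bs)"
      using act[of i] g[of i] by (simp add: hdts_cube_def)
  qed (simp add: T_map_def)
  show "Label (hdts_cube bs) (snd (T_map as bs f) u) = Label (hdts_cube as) u"
    if "u \<in> Actions (hdts_cube as)" for u
  proof -
    from that obtain i where i: "i \<in> {1..?m}" "u = cube_action as i" by (auto simp: hdts_cube_def)
    have "bs ! (?g i - 1) = as ! (i - 1)" using i(1) w pull_word_eq_iff by blast
    then show ?thesis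
      using act[OF i(1)] g[OF i(1)] i by (simp add: Label_hdts_cube)
  qed
  fix t assume t: "t \<in> Trans (hdts_cube as)"
  then obtain \<epsilon> "is" \<epsilon>' where *: "t = (\<epsilon>, map (cube_action as) is, \<epsilon>')" by (rule Trans_hdts_cubeE)
  note T = t[unfolded * Trans_hdts_cube_iff]
  have "map (snd (T_map as bs f)) (map (cube_action as) is) = map (cube_action bs) (map ?g is)"
    using T act by auto
  moreover have "(f \<epsilon>, map (cube_action bs) (map ?g is), f \<epsilon>') \<in> Trans (hdts_cube bs)"
  proof -
    have "f \<epsilon> ! (j - 1) \<le> f \<epsilon>' ! (j - 1) \<and>
        (f \<epsilon> ! (j - 1) \<noteq> f \<epsilon>' ! (j - 1) \<longleftrightarrow> j \<in> set (map ?g is))" if j: "j \<in> {1..?n}" for j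
    proof (cases "j \<in> ?g ` {1..?m}")
      case True
      then obtain i where i: "i \<in> {1..?m}" "j = ?g i" by blast
      have "j \<in> set (map ?g is) \<longleftrightarrow> i \<in> set is"
        using i T inj_on_image_mem_iff[OF inj_on_bar_inv[OF f], of i "set is"] by simp
      moreover have "f \<epsilon> ! (j - 1) = \<epsilon> ! (i - 1)" "f \<epsilon>' ! (j - 1) = \<epsilon>' ! (i - 1)"
        unfolding i(2) using T i(1) by (simp_all only: box_map_at_bar_inv[OF f])
      ultimately show ?thesis using T i(1) by simp
    next
      case False
      then have "j \<notin> set (map ?g is)" using T by auto
      moreover have "f \<epsilon> ! (j - 1) = f \<epsilon>' ! (j - 1)"
        using T j False by (intro box_map_off_bar_inv[OF f]) auto
      ultimately show ?thesis by simp
    qed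
    moreover have "distinct (map ?g is)"
      using T inj_on_subset[OF inj_on_bar_inv[OF f]] by (simp add: distinct_map)
    moreover have "set (map ?g is) \<subseteq> {1..?n}" using T g by auto
    moreover have "f \<epsilon> \<in> cube_vertices ?n" "f \<epsilon>' \<in> cube_vertices ?n"
      using T box_map_extensional[OF f] by auto
    ultimately show ?thesis using T unfolding Trans_hdts_cube_iff by blast
  qed
  ultimately show "case t of (\<alpha>, us, \<beta>) \<Rightarrow>
      (fst (T_map as bs f) \<alpha>, map (snd (T_map as bs f)) us, fst (T_map as bs f) \<beta>) \<in> Trans (hdts_cube bs)"
    by (simp add: * T_map_def del: map_map)
qed

text \<open>Everything is read off from the images of transitions that start at the initial vertex \<open>z\<close>: such
  a transition exists for every other vertex, and its image starts at the fixed vertex \<open>f z\<close>.\<close>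

lemma hdts_map_cube_eq_T_map:
  assumes \<phi>: "is_hdts_map (hdts_cube as) (hdts_cube bs) \<phi>"
  shows "is_box_map (length as) (length bs) (fst \<phi>)"
    and "pull_word (length as) (length bs) (fst \<phi>) bs = as"
    and "\<phi> = T_map as bs (fst \<phi>)"
proof -
  let ?m = "length as" and ?n = "length bs" and ?f = "fst \<phi>"
  \<comment> \<open>the action map in terms of indices\<close>
  define g where "g i = snd (snd \<phi> (cube_action as i))" for i
  have f: "?f \<in> cube_vertices ?m \<rightarrow>\<^sub>E cube_vertices ?n"
    using \<phi> by (simp add: is_hdts_map_def hdts_cube_def)
  have g: "g i \<in> {1..?n}" "snd \<phi> (cube_action as i) = cube_action bs (g i)"
      "bs ! (g i - 1) = as ! (i - 1)" if i: "i \<in> {1..?m}" for i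
  proof -
    have u: "cube_action as i \<in> Actions (hdts_cube as)" using i by (simp add: hdts_cube_def)
    have "snd \<phi> \<in> Actions (hdts_cube as) \<rightarrow>\<^sub>E Actions (hdts_cube bs)"
      and l: "Label (hdts_cube bs) (snd \<phi> (cube_action as i)) = Label (hdts_cube as) (cube_action as i)"
      using \<phi> u unfolding is_hdts_map_def by blast+
    then have v: "snd \<phi> (cube_action as i) \<in> Actions (hdts_cube bs)" using u by blast
    then obtain j where j: "j \<in> {1..?n}" "snd \<phi> (cube_action as i) = cube_action bs j"
      by (auto simp: hdts_cube_def)
    then have "g i = j" by (simp add: g_def cube_action_def)
    then show "g i \<in> {1..?n}" "snd \<phi> (cube_action as i) = cube_action bs (g i)"
      "bs ! (g i - 1) = as ! (i - 1)"
      using j l u v by (simp_all add: hdts_cube_def cube_action_def)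
  qed
  have trans: "distinct (map g is)"
      "\<And>j. j \<in> {1..?n} \<Longrightarrow> ?f \<epsilon> ! (j - 1) \<le> ?f \<epsilon>' ! (j - 1)"
      "\<And>j. j \<in> {1..?n} \<Longrightarrow> ?f \<epsilon> ! (j - 1) \<noteq> ?f \<epsilon>' ! (j - 1) \<longleftrightarrow> j \<in> g ` set is"
    if t: "(\<epsilon>, map (cube_action as) is, \<epsilon>') \<in> Trans (hdts_cube as)" for \<epsilon> "is" \<epsilon>'
  proof -
    have "set is \<subseteq> {1..?m}" using t by (simp add: Trans_hdts_cube_iff)
    then have "map (snd \<phi>) (map (cube_action as) is) = map (cube_action bs) (map g is)"
      using g(2) by auto
    moreover have "(?f \<epsilon>, map (snd \<phi>) (map (cube_action as) is), ?f \<epsilon>') \<in> Trans (hdts_cube bs)"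
      using \<phi> t unfolding is_hdts_map_def by blast
    ultimately have T: "(?f \<epsilon>, map (cube_action bs) (map g is), ?f \<epsilon>') \<in> Trans (hdts_cube bs)"
      by (simp only:)
    note T = T[unfolded Trans_hdts_cube_iff]
    show "distinct (map g is)" using T by blast
    show "?f \<epsilon> ! (j - 1) \<le> ?f \<epsilon>' ! (j - 1)" "?f \<epsilon> ! (j - 1) \<noteq> ?f \<epsilon>' ! (j - 1) \<longleftrightarrow> j \<in> g ` set is"
      if "j \<in> {1..?n}" for j
      using T that by auto
  qed
  define z where "z = replicate ?m False"
  have z: "z \<in> cube_vertices ?m" "\<And>i. i \<in> {1..?m} \<Longrightarrow> z ! (i - 1) = False"
    by (auto simp: z_def cube_vertices_def)
  have from_z: "(z, map (cube_action as) (filter (\<lambda>i. \<epsilon> ! (i - 1)) [1..<?m + 1]), \<epsilon>) \<in> Trans (hdts_cube as)"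
    if e: "\<epsilon> \<in> cube_vertices ?m" "\<epsilon> \<noteq> z" for \<epsilon>
  proof -
    have "\<exists>k<?m. \<epsilon> ! k"
    proof (rule ccontr)
      assume "\<not> (\<exists>k<?m. \<epsilon> ! k)"
      then have "\<epsilon> = z" using e(1) by (auto simp: z_def cube_vertices_def list_eq_iff_nth_eq)
      with e(2) show False by simp
    qed
    then obtain k where "k < ?m" "\<epsilon> ! k" by blast
    then have "Suc k \<in> set (filter (\<lambda>i. \<epsilon> ! (i - 1)) [1..<?m + 1])" by (auto simp del: upt_Suc)
    then have "filter (\<lambda>i. \<epsilon> ! (i - 1)) [1..<?m + 1] \<noteq> []"
      by (auto simp only: list.set empty_iff)
    then show ?thesis using e z by (auto simp: Trans_hdts_cube_iff simp del: upt_Suc)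
  qed
  have f_iff: "?f \<epsilon> ! (j - 1) \<noteq> ?f z ! (j - 1) \<longleftrightarrow> (\<exists>i\<in>{1..?m}. \<epsilon> ! (i - 1) \<and> g i = j)"
    "?f z ! (j - 1) \<le> ?f \<epsilon> ! (j - 1)"
    if "\<epsilon> \<in> cube_vertices ?m" "j \<in> {1..?n}" for \<epsilon> j
  proof (atomize (full), cases "\<epsilon> = z")
    case True
    then show "(?f \<epsilon> ! (j - 1) \<noteq> ?f z ! (j - 1) \<longleftrightarrow> (\<exists>i\<in>{1..?m}. \<epsilon> ! (i - 1) \<and> g i = j)) \<and>
        ?f z ! (j - 1) \<le> ?f \<epsilon> ! (j - 1)" using z(2) by auto
  next
    case False
    from trans(2,3)[OF from_z[OF that(1) False] that(2)]
    show "(?f \<epsilon> ! (j - 1) \<noteq> ?f z ! (j - 1) \<longleftrightarrow> (\<exists>i\<in>{1..?m}. \<epsilon> ! (i - 1) \<and> g i = j)) \<and>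
        ?f z ! (j - 1) \<le> ?f \<epsilon> ! (j - 1)"
      by (auto simp del: upt_Suc)
  qed
  define e where "e = replicate ?m True"
  have e: "e \<in> cube_vertices ?m" "\<And>i. i \<in> {1..?m} \<Longrightarrow> e ! (i - 1)"
    by (auto simp: e_def cube_vertices_def)
  \<comment> \<open>a cube of dimension 0 has no transition from \<open>z\<close> to \<open>e\<close>, since these vertices coincide\<close>
  have inj: "inj_on g {1..?m}"
  proof (cases "?m = 0")
    case False
    then have "1 \<in> {1..?m}" by (simp add: Suc_le_eq)
    then have "e \<noteq> z" using e(2) z(2) by blast
    moreover have "filter (\<lambda>i. e ! (i - 1)) [1..<?m + 1] = [1..<?m + 1]"
      using e(2) by (auto simp: filter_id_conv simp del: upt_Suc)
    ultimately have "distinct (map g [1..<?m + 1])"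
      using trans(1)[OF from_z[OF e(1)]] by simp
    then show ?thesis by (simp add: distinct_map atLeastLessThanSuc_atLeastAtMost del: upt_Suc)
  qed simp
  \<comment> \<open>the coordinate \<open>g i\<close> changes from \<open>f z\<close> to \<open>f e\<close>, hence is 0 at \<open>f z\<close>\<close>
  have f_at: "?f \<epsilon> ! (g i - 1) \<longleftrightarrow> \<epsilon> ! (i - 1)" if "\<epsilon> \<in> cube_vertices ?m" "i \<in> {1..?m}" for \<epsilon> i
  proof -
    have "?f e ! (g i - 1) \<noteq> ?f z ! (g i - 1)" "?f z ! (g i - 1) \<le> ?f e ! (g i - 1)"
      using f_iff[OF e(1) g(1)] e(2) that(2) by blast+
    then have "\<not> ?f z ! (g i - 1)" by simp
    moreover have "(\<exists>i'\<in>{1..?m}. \<epsilon> ! (i' - 1) \<and> g i' = g i) \<longleftrightarrow> \<epsilon> ! (i - 1)"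
      using inj_onD[OF inj] that(2) by blast
    ultimately show ?thesis using f_iff(1)[OF that(1) g(1)[OF that(2)]] by simp
  qed
  \<comment> \<open>the coordinates not reached by \<open>g\<close> keep the constant value that they have at \<open>f z\<close>\<close>
  define h where "h = (\<lambda>j\<in>{1..?n}. if j \<in> g ` {1..?m} then Fin (inv_into {1..?m} g j)
    else if ?f z ! (j - 1) then Pinf else Minf)"
  have hg: "h (g i) = Fin i" if "i \<in> {1..?m}" for i
    using that g(1)[OF that] inj by (simp add: h_def)
  have hat: "is_hat ?m ?n ?f h"
  proof (rule is_hatI)
    show "h \<in> {1..?n} \<rightarrow>\<^sub>E Fin ` {1..?m} \<union> {Minf, Pinf}"
    proof (rule PiE_I)
      fix j assume j: "j \<in> {1..?n}"
      show "h j \<in> Fin ` {1..?m} \<union> {Minf, Pinf}"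
      proof (cases "j \<in> g ` {1..?m}")
        case True
        then show ?thesis using hg by auto
      next
        case False
        then show ?thesis using j by (simp add: h_def)
      qed
    qed (auto simp: h_def)
    show "length (?f \<epsilon>) = ?n" if "length \<epsilon> = ?m" for \<epsilon>
      using f that by (auto simp: cube_vertices_def)
    show "?f \<epsilon> ! k = coordinate \<epsilon> (h (Suc k))" if "length \<epsilon> = ?m" and k: "k < ?n" for \<epsilon> k
    proof -
      have e: "\<epsilon> \<in> cube_vertices ?m" using that by (simp add: cube_vertices_def)
      show ?thesis
      proof (cases "Suc k \<in> g ` {1..?m}")
        case True
        then obtain i where i: "i \<in> {1..?m}" "Suc k = g i" by blast
        show ?thesis using f_at[OF e i(1)] hg[OF i(1)] unfolding i(2)[symmetric] by simp
      next
        case False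
        then have "\<not> (\<exists>i\<in>{1..?m}. \<epsilon> ! (i - 1) \<and> g i = Suc k)" by (metis imageI)
        moreover have "Suc k \<in> {1..?n}" using k by simp
        ultimately have "\<not> ?f \<epsilon> ! (Suc k - 1) \<noteq> ?f z ! (Suc k - 1)"
          using f_iff(1)[OF e] by blast
        then have "?f \<epsilon> ! k = ?f z ! k" by simp
        then show ?thesis using False k by (simp add: h_def)
      qed
    qed
  qed
  have "is_bijective_hat ?m ?n h"
    unfolding is_bijective_hat_def
  proof
    fix i assume i: "i \<in> {1..?m}"
    show "\<exists>!j. j \<in> {1..?n} \<and> h j = Fin i"
    proof (rule ex1I[of _ "g i"])
      fix j assume j: "j \<in> {1..?n} \<and> h j = Fin i"
      then have "j \<in> g ` {1..?m}" by (auto simp: h_def split: if_splits)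
      then show "j = g i" using j hg by auto
    qed (use i g hg in blast)
  qed
  with hat show box: "is_box_map ?m ?n ?f"
    using f by (auto simp: is_box_map_iff PiE_def)
  have bar: "bar_inv ?m ?n ?f i = g i" if "i \<in> {1..?m}" for i
    using that g(1) hg by (intro bar_inv_eqI[OF box]) (simp_all add: hat_eqI[OF hat])
  show "pull_word ?m ?n ?f bs = as"
    using g(3) bar by (simp add: pull_word_eq_iff)
  then have "snd (T_map as bs ?f) u = snd \<phi> u" if "u \<in> Actions (hdts_cube as)" for u
    using that g(2) bar by (auto simp: hdts_cube_def snd_T_map_cube_action)
  moreover have "snd \<phi> \<in> extensional (Actions (hdts_cube as))"
    using \<phi> by (auto simp: is_hdts_map_def PiE_def)
  moreover have "snd (T_map as bs ?f) \<in> extensional (Actions (hdts_cube as))"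
    by (simp add: T_map_def)
  ultimately have "snd (T_map as bs ?f) = snd \<phi>" by (auto intro: extensionalityI)
  then show "\<phi> = T_map as bs ?f" by (simp add: T_map_def prod_eq_iff)
qed

section \<open>Objects and arrows of the two categories of cubes\<close>

lemma is_presheaf_label_presheaf: "is_presheaf box_category (label_presheaf \<Sigma>)"
  and Sec_label_presheaf: "Sec (label_presheaf \<Sigma>) n = words \<Sigma> n"
  using word_presheaf_is_label_presheaf[of \<Sigma>]
  unfolding label_presheaf_eq is_label_presheaf_def by blast+

lemma Res_label_presheaf:
  assumes "is_box_map m n f" "w \<in> words \<Sigma> n"
  shows "Res (label_presheaf \<Sigma>) (m, f, n) w = pull_word m n f w"
  using assms by (simp add: label_presheaf_eq word_presheaf_def box_category_def)

lemma Obj_box_category: "Obj box_category = UNIV"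
  and Ide_box_category: "Ide box_category n = (n, \<lambda>\<epsilon>\<in>cube_vertices n. \<epsilon>, n)"
  and Cmp_box_category: "Cmp box_category (n, g, p) (m, f, n') = (m, compose (cube_vertices m) g f, p)"
  and hom_set_box_category_iff:
    "(m, f, n) \<in> hom_set box_category m' n' \<longleftrightarrow> is_box_map m n f \<and> m = m' \<and> n = n'"
  by (auto simp: box_category_def hom_set_def)

lemma lists_imp_words: "as \<in> lists \<Sigma> \<Longrightarrow> as \<in> words \<Sigma> (length as)"
  by (auto simp: words_def lists_eq_set)

text \<open>Both categories of cubes have these triples as their arrows, through the two encodings
  \<open>precubical_arrow\<close> and \<open>hdts_arrow\<close>; the functor intertwines the encodings.\<close>

definition labelled_box_maps :: "'s set \<Rightarrow> ('s list \<times> (bool list \<Rightarrow> bool list) \<times> 's list) set" where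
  "labelled_box_maps \<Sigma> = {(as, f, bs). as \<in> lists \<Sigma> \<and> bs \<in> lists \<Sigma> \<and>
     is_box_map (length as) (length bs) f \<and> pull_word (length as) (length bs) f bs = as}"

definition precubical_arrow ::
  "'s set \<Rightarrow> 's list \<times> (bool list \<Rightarrow> bool list) \<times> 's list \<Rightarrow> 's labelled_box_map" where
  "precubical_arrow \<Sigma> = (\<lambda>(as, f, bs). (labelled_box \<Sigma> as,
     yoneda_map box_category (representable box_category (length bs)) (length as)
       (length as, f, length bs),
     labelled_box \<Sigma> bs))"

definition hdts_arrow ::
  "'s list \<times> (bool list \<Rightarrow> bool list) \<times> 's list \<Rightarrow> (bool list, 's \<times> nat, 's) hdts_map" where
  "hdts_arrow = (\<lambda>(as, f, bs). (hdts_cube as, T_map as bs f, hdts_cube bs))"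

lemma is_over_labelled_box:
  "as \<in> lists \<Sigma> \<Longrightarrow> is_over box_category (label_presheaf \<Sigma>) (labelled_box \<Sigma> as)"
  unfolding labelled_box_def
  by (rule is_over_yoneda_map[OF is_category_box_category is_presheaf_label_presheaf])
    (simp add: Sec_label_presheaf lists_imp_words)

lemma Obj_CUBE_precubical: "Obj (CUBE_precubical \<Sigma>) = labelled_box \<Sigma> ` lists \<Sigma>"
  by (auto simp: CUBE_precubical_def full_subcategory_def comma_category_def is_over_labelled_box[unfolded in_lists_conv_set])

lemma is_over_map_labelled_box_iff:
  assumes "as \<in> lists \<Sigma>" "bs \<in> lists \<Sigma>"
  shows "is_over_map box_category (labelled_box \<Sigma> as) (labelled_box \<Sigma> bs) \<eta> \<longleftrightarrow>
    (\<exists>f. (as, f, bs) \<in> labelled_box_maps \<Sigma> \<and>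
      \<eta> = yoneda_map box_category (representable box_category (length bs)) (length as)
        (length as, f, length bs))"
  using is_over_map_yoneda_map_iff[OF is_category_box_category is_presheaf_label_presheaf,
      of "length as" "length bs" as \<Sigma> bs \<eta>] assms lists_imp_words[OF assms(1)] lists_imp_words[OF assms(2)]
  unfolding labelled_box_def
  by (auto simp: Sec_label_presheaf hom_set_def box_category_def[THEN arg_cong[of _ _ Obj]]
      labelled_box_maps_def Res_label_presheaf) (auto simp: box_category_def Res_label_presheaf)

lemma Arr_CUBE_precubical: "Arr (CUBE_precubical \<Sigma>) = precubical_arrow \<Sigma> ` labelled_box_maps \<Sigma>"
proof -
  have "Arr (CUBE_precubical \<Sigma>) =
      {(X, \<eta>, Y). X \<in> labelled_box \<Sigma> ` lists \<Sigma> \<and> Y \<in> labelled_box \<Sigma> ` lists \<Sigma> \<and>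
        is_over_map box_category X Y \<eta>}"
    by (auto simp: CUBE_precubical_def full_subcategory_def comma_category_def is_over_labelled_box[unfolded in_lists_conv_set])
  also have "\<dots> = precubical_arrow \<Sigma> ` labelled_box_maps \<Sigma>"
  proof (intro equalityI subsetI)
    fix t assume "t \<in> {(X, \<eta>, Y). X \<in> labelled_box \<Sigma> ` lists \<Sigma> \<and> Y \<in> labelled_box \<Sigma> ` lists \<Sigma> \<and>
        is_over_map box_category X Y \<eta>}"
    then obtain as bs \<eta> where t: "t = (labelled_box \<Sigma> as, \<eta>, labelled_box \<Sigma> bs)"
      and *: "as \<in> lists \<Sigma>" "bs \<in> lists \<Sigma>"
      and \<eta>: "is_over_map box_category (labelled_box \<Sigma> as) (labelled_box \<Sigma> bs) \<eta>" by blast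
    from \<eta> obtain f where "(as, f, bs) \<in> labelled_box_maps \<Sigma>" "t = precubical_arrow \<Sigma> (as, f, bs)"
      unfolding is_over_map_labelled_box_iff[OF *] by (auto simp: t precubical_arrow_def)
    then show "t \<in> precubical_arrow \<Sigma> ` labelled_box_maps \<Sigma>" by blast
  next
    fix t assume "t \<in> precubical_arrow \<Sigma> ` labelled_box_maps \<Sigma>"
    then obtain as f bs where t: "t = precubical_arrow \<Sigma> (as, f, bs)"
      and f: "(as, f, bs) \<in> labelled_box_maps \<Sigma>" by auto
    then have *: "as \<in> lists \<Sigma>" "bs \<in> lists \<Sigma>" by (simp_all add: labelled_box_maps_def)
    have "is_over_map box_category (labelled_box \<Sigma> as) (labelled_box \<Sigma> bs)
        (yoneda_map box_category (representable box_category (length bs)) (length as)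
          (length as, f, length bs))"
      unfolding is_over_map_labelled_box_iff[OF *] by (rule exI[of _ f]) (intro conjI f refl)
    with * show "t \<in> {(X, \<eta>, Y). X \<in> labelled_box \<Sigma> ` lists \<Sigma> \<and> Y \<in> labelled_box \<Sigma> ` lists \<Sigma> \<and>
        is_over_map box_category X Y \<eta>}"
      unfolding t precubical_arrow_def by simp
  qed
  finally show ?thesis .
qed

lemma Obj_CUBE_WHDTS: "Obj (CUBE_WHDTS \<Sigma>) = hdts_cube ` lists \<Sigma>"
  by (auto simp: CUBE_WHDTS_def full_subcategory_def WHDTS_def is_whdts_hdts_cube[unfolded in_lists_conv_set])

lemma Arr_CUBE_WHDTS: "Arr (CUBE_WHDTS \<Sigma>) = hdts_arrow ` labelled_box_maps \<Sigma>"
proof -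
  have "Arr (CUBE_WHDTS \<Sigma>) =
      {(X, \<phi>, Y). X \<in> hdts_cube ` lists \<Sigma> \<and> Y \<in> hdts_cube ` lists \<Sigma> \<and> is_hdts_map X Y \<phi>}"
    by (auto simp: CUBE_WHDTS_def full_subcategory_def WHDTS_def is_whdts_hdts_cube[unfolded in_lists_conv_set])
  also have "\<dots> = hdts_arrow ` labelled_box_maps \<Sigma>"
  proof (intro equalityI subsetI)
    fix t assume "t \<in> {(X, \<phi>, Y). X \<in> hdts_cube ` lists \<Sigma> \<and> Y \<in> hdts_cube ` lists \<Sigma> \<and> is_hdts_map X Y \<phi>}"
    then obtain as bs \<phi> where t: "t = (hdts_cube as, \<phi>, hdts_cube bs)"
      and "as \<in> lists \<Sigma>" "bs \<in> lists \<Sigma>" "is_hdts_map (hdts_cube as) (hdts_cube bs) \<phi>" by blast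
    then have "(as, fst \<phi>, bs) \<in> labelled_box_maps \<Sigma>" "t = hdts_arrow (as, fst \<phi>, bs)"
      using hdts_map_cube_eq_T_map[of as bs \<phi>] by (simp_all add: labelled_box_maps_def hdts_arrow_def)
    then show "t \<in> hdts_arrow ` labelled_box_maps \<Sigma>" by blast
  qed (auto simp: labelled_box_maps_def hdts_arrow_def is_hdts_map_T_map)
  finally show ?thesis .
qed

section \<open>The functor on labelled cubes\<close>

text \<open>The functor evaluates a natural transformation at the identity, which returns the map of cubes
  that it came from.\<close>

lemma T_arr_precubical_arrow:
  assumes "t \<in> labelled_box_maps \<Sigma>"
  shows "T_arr \<Sigma> (precubical_arrow \<Sigma> t) = hdts_arrow t"
proof -
  obtain as f bs where t: "t = (as, f, bs)" by (rule prod_cases3)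
  have *: "as \<in> lists \<Sigma>" "bs \<in> lists \<Sigma>" "is_box_map (length as) (length bs) f"
    using assms by (auto simp: t labelled_box_maps_def)
  have "yoneda_map box_category (representable box_category (length bs)) (length as)
       (length as, f, length bs) (length as) (Ide box_category (length as)) = (length as, f, length bs)"
    using *(3) by (intro yoneda_map_identity is_category_box_category is_presheaf_representable)
      (simp_all add: representable_def hom_set_def box_category_def)
  then show ?thesis
    using * by (simp add: t T_arr_def precubical_arrow_def hdts_arrow_def underlying_map_def
        T_obj_labelled_box box_word_labelled_box)
qed

lemma T_map_compose:
  assumes "(as, f, bs) \<in> labelled_box_maps \<Sigma>" "(bs, g, cs) \<in> labelled_box_maps \<Sigma>"
  shows "T_map as cs (compose (cube_vertices (length as)) g f) =
    (compose (States (hdts_cube as)) (fst (T_map bs cs g)) (fst (T_map as bs f)),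
     compose (Actions (hdts_cube as)) (snd (T_map bs cs g)) (snd (T_map as bs f)))"
proof -
  let ?h = "compose (cube_vertices (length as)) g f"
  have f: "is_box_map (length as) (length bs) f" "pull_word (length as) (length bs) f bs = as"
    and g: "is_box_map (length bs) (length cs) g" "pull_word (length bs) (length cs) g cs = bs"
    using assms by (auto simp: labelled_box_maps_def)
  have "pull_word (length as) (length cs) ?h cs = as"
    by (simp add: pull_word_comp[OF f(1) g(1)] f(2) g(2))
  then have "snd (T_map as cs ?h) (cube_action as i) =
      snd (T_map bs cs g) (snd (T_map as bs f) (cube_action as i))" if "i \<in> {1..length as}" for i
    using that f(2) g(2) bar_inv_props(1)[OF f(1) that]
    by (simp add: snd_T_map_cube_action bar_inv_comp[OF f(1) g(1)])
  then have *: "snd (T_map as cs ?h) u = snd (T_map bs cs g) (snd (T_map as bs f) u)"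
    if "u \<in> Actions (hdts_cube as)" for u
    using that by (auto simp: hdts_cube_def)
  have "snd (T_map as cs ?h) =
      compose (Actions (hdts_cube as)) (snd (T_map bs cs g)) (snd (T_map as bs f))"
  proof (rule extensionalityI)
    show "snd (T_map as cs ?h) \<in> extensional (Actions (hdts_cube as))" by (simp add: T_map_def)
  qed (simp_all add: * compose_eq)
  then show ?thesis by (simp add: T_map_def hdts_cube_def)
qed

lemma precubical_arrow_compose:
  assumes "(as, f, bs) \<in> labelled_box_maps \<Sigma>" "(bs, g, cs) \<in> labelled_box_maps \<Sigma>"
  shows "(as, compose (cube_vertices (length as)) g f, cs) \<in> labelled_box_maps \<Sigma>"
    and "Cmp (CUBE_precubical \<Sigma>) (precubical_arrow \<Sigma> (bs, g, cs)) (precubical_arrow \<Sigma> (as, f, bs)) =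
      precubical_arrow \<Sigma> (as, compose (cube_vertices (length as)) g f, cs)"
proof -
  let ?h = "compose (cube_vertices (length as)) g f"
  have f: "is_box_map (length as) (length bs) f" "pull_word (length as) (length bs) f bs = as"
    and g: "is_box_map (length bs) (length cs) g" "pull_word (length bs) (length cs) g cs = bs"
    using assms by (auto simp: labelled_box_maps_def)
  show "(as, ?h, cs) \<in> labelled_box_maps \<Sigma>"
    using assms box_comp[OF f(1) g(1)] pull_word_comp[OF f(1) g(1), of cs] f(2) g(2)
    by (simp add: labelled_box_maps_def)
  have hom: "(length as, f, length bs) \<in> hom_set box_category (length as) (length bs)"
    "(length bs, g, length cs) \<in> hom_set box_category (length bs) (length cs)"
    using f g by (simp_all add: hom_set_box_category_iff)
  show "Cmp (CUBE_precubical \<Sigma>) (precubical_arrow \<Sigma> (bs, g, cs)) (precubical_arrow \<Sigma> (as, f, bs)) =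
      precubical_arrow \<Sigma> (as, ?h, cs)"
    using yoneda_map_representable_compose[OF is_category_box_category hom]
    by (simp add: CUBE_precubical_def full_subcategory_def comma_category_def precubical_arrow_def
        labelled_box_def Cmp_box_category)
qed

theorem is_functor_T: "is_functor (CUBE_precubical \<Sigma>) (CUBE_WHDTS \<Sigma>) (T_obj \<Sigma>) (T_arr \<Sigma>)"
  unfolding is_functor_def
proof (intro conjI ballI impI)
  show "is_category (CUBE_precubical \<Sigma>)"
    unfolding CUBE_precubical_def
    by (intro is_category_full_subcategory is_category_comma_category is_category_box_category)
  show "is_category (CUBE_WHDTS \<Sigma>)"
    unfolding CUBE_WHDTS_def by (intro is_category_full_subcategory is_category_WHDTS)
next
  fix X assume "X \<in> Obj (CUBE_precubical \<Sigma>)"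
  then obtain as where as: "as \<in> lists \<Sigma>" "X = labelled_box \<Sigma> as"
    by (auto simp: Obj_CUBE_precubical)
  then show "T_obj \<Sigma> X \<in> Obj (CUBE_WHDTS \<Sigma>)"
    by (simp add: Obj_CUBE_WHDTS T_obj_labelled_box)
  let ?id = "\<lambda>\<epsilon>\<in>cube_vertices (length as). \<epsilon>"
  have w: "pull_word (length as) (length as) ?id as = as"
    by (simp add: pull_word_eq_iff bar_inv_id)
  then have t: "(as, ?id, as) \<in> labelled_box_maps \<Sigma>"
    using as by (simp add: labelled_box_maps_def box_id)
  have "Ide (CUBE_precubical \<Sigma>) X = precubical_arrow \<Sigma> (as, ?id, as)"
    using yoneda_map_representable_identity[OF is_category_box_category, of "length as"]
    by (simp add: as CUBE_precubical_def full_subcategory_def comma_category_def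
        precubical_arrow_def labelled_box_def Obj_box_category Ide_box_category)
  moreover have "T_map as as ?id =
      (\<lambda>\<alpha>\<in>States (hdts_cube as). \<alpha>, \<lambda>u\<in>Actions (hdts_cube as). u)"
    by (auto simp: T_map_def hdts_cube_def cube_action_def bar_inv_id intro!: restrict_ext)
  ultimately show "T_arr \<Sigma> (Ide (CUBE_precubical \<Sigma>) X) = Ide (CUBE_WHDTS \<Sigma>) (T_obj \<Sigma> X)"
    using as by (simp add: T_arr_precubical_arrow[OF t] hdts_arrow_def T_obj_labelled_box
        CUBE_WHDTS_def full_subcategory_def WHDTS_def)
next
  have DC: "Dom (CUBE_precubical \<Sigma>) (precubical_arrow \<Sigma> (as, f, bs)) = labelled_box \<Sigma> as"
    "Cod (CUBE_precubical \<Sigma>) (precubical_arrow \<Sigma> (as, f, bs)) = labelled_box \<Sigma> bs"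
    "Dom (CUBE_WHDTS \<Sigma>) (hdts_arrow (as, f, bs)) = hdts_cube as"
    "Cod (CUBE_WHDTS \<Sigma>) (hdts_arrow (as, f, bs)) = hdts_cube bs" for as f bs
    by (simp_all add: CUBE_precubical_def full_subcategory_def comma_category_def
        precubical_arrow_def hdts_arrow_def CUBE_WHDTS_def WHDTS_def)
  {
    fix x assume "x \<in> Arr (CUBE_precubical \<Sigma>)"
    then obtain as f bs where x: "x = precubical_arrow \<Sigma> (as, f, bs)"
      and t: "(as, f, bs) \<in> labelled_box_maps \<Sigma>"
      by (auto simp: Arr_CUBE_precubical)
    then have "as \<in> lists \<Sigma>" "bs \<in> lists \<Sigma>" by (simp_all add: labelled_box_maps_def)
    then show "T_arr \<Sigma> x \<in> Arr (CUBE_WHDTS \<Sigma>)"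
      "Dom (CUBE_WHDTS \<Sigma>) (T_arr \<Sigma> x) = T_obj \<Sigma> (Dom (CUBE_precubical \<Sigma>) x)"
      "Cod (CUBE_WHDTS \<Sigma>) (T_arr \<Sigma> x) = T_obj \<Sigma> (Cod (CUBE_precubical \<Sigma>) x)"
      using t by (simp_all add: x T_arr_precubical_arrow[OF t] DC T_obj_labelled_box Arr_CUBE_WHDTS)
  }
  fix x y assume "x \<in> Arr (CUBE_precubical \<Sigma>)" "y \<in> Arr (CUBE_precubical \<Sigma>)"
    and xy: "Cod (CUBE_precubical \<Sigma>) x = Dom (CUBE_precubical \<Sigma>) y"
  then obtain as f bs bs' g cs where x: "x = precubical_arrow \<Sigma> (as, f, bs)"
    and y: "y = precubical_arrow \<Sigma> (bs', g, cs)"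
    and t: "(as, f, bs) \<in> labelled_box_maps \<Sigma>" and u': "(bs', g, cs) \<in> labelled_box_maps \<Sigma>"
    by (auto simp: Arr_CUBE_precubical)
  have "bs \<in> lists \<Sigma>" "bs' \<in> lists \<Sigma>" using t u' by (simp_all add: labelled_box_maps_def)
  then have b: "bs' = bs" using xy by (simp add: x y DC labelled_box_inject)
  note u = u'[unfolded b]
  show "T_arr \<Sigma> (Cmp (CUBE_precubical \<Sigma>) y x) = Cmp (CUBE_WHDTS \<Sigma>) (T_arr \<Sigma> y) (T_arr \<Sigma> x)"
    by (simp add: x y b precubical_arrow_compose[OF t u] T_arr_precubical_arrow t u hdts_arrow_def
        T_map_compose[OF t u] CUBE_WHDTS_def full_subcategory_def WHDTS_def)
qed

theorem theorem8p5:
  fixes \<Sigma> :: "'s set"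
  assumes "\<Sigma> \<noteq> {}"
  shows "is_isomorphism_of_categories (CUBE_precubical \<Sigma>) (CUBE_WHDTS \<Sigma>) (T_obj \<Sigma>) (T_arr \<Sigma>)"
proof (rule is_isomorphism_of_categoriesI[OF is_functor_T])
  show "bij_betw (T_obj \<Sigma>) (Obj (CUBE_precubical \<Sigma>)) (Obj (CUBE_WHDTS \<Sigma>))"
    unfolding Obj_CUBE_precubical Obj_CUBE_WHDTS
    by (rule bij_betw_imageI)
      (auto simp: inj_on_def T_obj_labelled_box hdts_cube_inject image_image)
  have inj: "inj hdts_arrow"
    by (auto simp: inj_def hdts_arrow_def hdts_cube_inject T_map_def)
  show "bij_betw (T_arr \<Sigma>) (Arr (CUBE_precubical \<Sigma>)) (Arr (CUBE_WHDTS \<Sigma>))"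
    unfolding Arr_CUBE_precubical Arr_CUBE_WHDTS
  proof (rule bij_betw_imageI)
    show "inj_on (T_arr \<Sigma>) (precubical_arrow \<Sigma> ` labelled_box_maps \<Sigma>)"
    proof (rule inj_onI, elim imageE)
      fix x y t u assume "T_arr \<Sigma> x = T_arr \<Sigma> y" "x = precubical_arrow \<Sigma> t" "t \<in> labelled_box_maps \<Sigma>"
        "y = precubical_arrow \<Sigma> u" "u \<in> labelled_box_maps \<Sigma>"
      then show "x = y" using injD[OF inj, of t u] by (simp add: T_arr_precubical_arrow)
    qed
    show "T_arr \<Sigma> ` precubical_arrow \<Sigma> ` labelled_box_maps \<Sigma> = hdts_arrow ` labelled_box_maps \<Sigma>"
      unfolding image_image by (rule image_cong) (simp_all add: T_arr_precubical_arrow)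
  qed
qed

end
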